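(* Let $G=(V,E)$ be a simple connected graph on $|V|=N\ge 3$ vertices, and let $\mathrm{I}(k)$ be the number of spanning forests of $G$ with $k$ edges. Then $$\frac{\mathrm I(N-2)^2}{\mathrm I(N-3)\cdot \mathrm I(N-1)}\ \ge\ \frac32\Bigl(1+\frac{1}{N-2}\Bigr),$$ and equality holds if and only if $G$ is an $N$-cycle.
   Context: A spanning forest with $k$ edges is a set of $k$ edges of $G$ containing no cycle (equivalently, an independent set of size $k$ in the graphical matroid of $G$). *)

theory Defs
  imports Complex_Main
begin

(* An edge is the two-element set of its end vertices, so loops and multiple edges are excluded. *)
definition simple_graph :: "'a set \<Rightarrow> 'a set set \<Rightarrow> bool" where
  "simple_graph V E \<longleftrightarrow> finite V \<and> (\<forall>e\<in>E. e \<subseteq> V \<and> card e = 2)"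

definition connected_graph :: "'a set \<Rightarrow> 'a set set \<Rightarrow> bool" where
  "connected_graph V E \<longleftrightarrow>
     V \<noteq> {} \<and> (\<forall>u\<in>V. \<forall>v\<in>V. (u, v) \<in> {(x, y). {x, y} \<in> E}\<^sup>*)"

definition cycle_edges :: "'a list \<Rightarrow> 'a set set" where
  "cycle_edges vs = {{vs ! i, vs ! (Suc i mod length vs)} | i. i < length vs}"

(* vs lists the vertices of a cycle in cyclic order, the first vertex not being repeated. *)
definition cycle_list :: "'a list \<Rightarrow> bool" where
  "cycle_list vs \<longleftrightarrow> 3 \<le> length vs \<and> distinct vs"

definition is_cycle_graph :: "'a set \<Rightarrow> 'a set set \<Rightarrow> bool" where
  "is_cycle_graph V E \<longleftrightarrow> (\<exists>vs. cycle_list vs \<and> V = set vs \<and> E = cycle_edges vs)"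

definition acyclic_edges :: "'a set set \<Rightarrow> bool" where
  "acyclic_edges F \<longleftrightarrow> \<not> (\<exists>vs. cycle_list vs \<and> cycle_edges vs \<subseteq> F)"

definition spanning_forests :: "'a set set \<Rightarrow> nat \<Rightarrow> 'a set set set" where
  "spanning_forests E k = {F. F \<subseteq> E \<and> card F = k \<and> acyclic_edges F}"

definition num_forests :: "'a set set \<Rightarrow> nat \<Rightarrow> nat" where
  "num_forests E k = card (spanning_forests E k)"

end

theory Submission
  imports Defs
begin

text \<open>Let \<open>r = N - 1\<close> be the rank of the graphic matroid. Contracting
  a forest \<open>A\<close> with \<open>r - 2\<close> edges leaves three vertices joined by \<open>a\<close>, \<open>b\<close>, \<open>c\<close> parallel
  edges, and the inequality for that contraction reads \<open>(a + b + c)\<^sup>2 \<ge> 3 (ab + bc + ca)\<close>. To average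
  over all \<open>A\<close> one needs more than this scalar inequality, namely its quadratic-form version: on the
  space spanned by the edges and one extra coordinate \<open>x\<^sub>0\<close>, the second derivatives of
  \<open>f\<^sub>r + x\<^sub>0 f\<^bsub>r-1\<^esub> + 3/4 x\<^sub>0\<^sup>2 f\<^bsub>r-2\<^esub>\<close>, where \<open>f\<^sub>k\<close> is the generating polynomial of the forests with \<open>k\<close>
  edges, form a Lorentzian quadratic form. That property passes from the contractions \<open>G/e\<close> to \<open>G\<close>, in
  the spirit of Lorentzian polynomials and combinatorial atlases, and reverse Cauchy--Schwarz for
  the vectors \<open>x\<^sub>0\<close> and \<open>(1, \<dots>, 1)\<close> gives the claim.

  Equality is inherited by all contractions and forces \<open>a = b = c = m\<close> with the same \<open>m\<close> for every \<open>A\<close>.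
  Since \<open>G\<close> is simple, contracting a tree that misses exactly two vertices shows \<open>m = 1\<close>. Then every
  spanning tree has exactly one edge outside it, and \<open>E\<close> is a single circuit.\<close>

section \<open>Laplace equations and the form \<open>e\<^sub>2\<close>\<close>

text \<open>The induction eliminates a vertex by the star-mesh transformation.\<close>

lemma laplacian_solvable:
  fixes M :: "'i \<Rightarrow> 'i \<Rightarrow> real" and b :: "'i \<Rightarrow> real"
  assumes "finite I"
    and "\<And>i j. i \<in> I \<Longrightarrow> j \<in> I \<Longrightarrow> M i j = M j i"
    and "\<And>i j. i \<in> I \<Longrightarrow> j \<in> I \<Longrightarrow> 0 \<le> M i j"
    and "\<And>S. S \<subseteq> I \<Longrightarrow> S \<noteq> {} \<Longrightarrow> S \<noteq> I \<Longrightarrow> \<exists>i\<in>S. \<exists>j\<in>I - S. 0 < M i j"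
    and "sum b I = 0"
  shows "\<exists>z. \<forall>i\<in>I. (\<Sum>j\<in>I. M i j * (z i - z j)) = b i"
  using assms
proof (induction I arbitrary: M b rule: finite_induct)
  case empty
  then show ?case by simp
next
  case (insert k J)
  show ?case
  proof (cases "J = {}")
    case True
    then show ?thesis using insert.prems(4) by simp
  next
    case False
    define d where "d = (\<Sum>j\<in>J. M k j)"
    have sym: "M i j = M j i" if "i \<in> insert k J" "j \<in> insert k J" for i j
      using insert.prems(1) that by blast
    have nn: "0 \<le> M i j" if "i \<in> insert k J" "j \<in> insert k J" for i j
      using insert.prems(2) that by blast
    obtain j0 where j0: "j0 \<in> J" "0 < M k j0"
      using insert.prems(3)[of "{k}"] False insert.hyps(2) by auto
    have d: "d > 0"
      unfolding d_def using j0 insert.hyps(1) nn by (intro sum_pos2[of _ j0]) auto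
    \<comment> \<open>The star-mesh weights: eliminating \<open>k\<close> adds a conductance
      \<open>M i k * M k j / d\<close> between the remaining vertices, and \<open>b'\<close> spreads
      the source at \<open>k\<close> in proportion to \<open>M i k\<close>.\<close>
    define M' where "M' i j = M i j + M i k * M k j / d" for i j
    define b' where "b' i = b i + M i k * b k / d" for i
    have "\<exists>z. \<forall>i\<in>J. (\<Sum>j\<in>J. M' i j * (z i - z j)) = b' i"
    proof (rule insert.IH)
      show "M' i j = M' j i" if "i \<in> J" "j \<in> J" for i j
        using sym[of i j] sym[of i k] sym[of k j] that by (simp add: M'_def)
      show "0 \<le> M' i j" if "i \<in> J" "j \<in> J" for i j
        using nn that d by (auto simp: M'_def)
      show "\<exists>i\<in>S. \<exists>j\<in>J - S. 0 < M' i j" if S: "S \<subseteq> J" "S \<noteq> {}" "S \<noteq> J" for S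
      proof -
        have pos1: "0 < M' i j" if "i \<in> J" "j \<in> J" "0 < M i j" for i j
          using nn[of i k] nn[of k j] that d unfolding M'_def
          by (intro add_pos_nonneg) auto
        have pos2: "0 < M' i j" if "i \<in> J" "j \<in> J" "0 < M i k" "0 < M k j" for i j
          using nn[of i j] that d unfolding M'_def
          by (intro add_nonneg_pos) auto
        have kS: "k \<notin> S" using S insert.hyps by auto
        \<comment> \<open>The cut \<open>S\<close> of \<open>J\<close> extends to two cuts of
          \<open>insert k J\<close>, with \<open>k\<close> outside and with \<open>k\<close> inside.
          If both edges found end in \<open>k\<close>, the path through \<open>k\<close> has
          positive star-mesh weight.\<close>
        have "\<exists>i\<in>S. \<exists>j\<in>insert k J - S. 0 < M i j"
          by (rule insert.prems(3)) (use S kS in auto)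
        then obtain i j where ij: "i \<in> S" "j \<in> insert k J - S" "0 < M i j" by blast
        have "\<exists>i\<in>insert k S. \<exists>j\<in>insert k J - insert k S. 0 < M i j"
          by (rule insert.prems(3)) (use S kS insert.hyps in auto)
        then obtain i' j' where
          ij': "i' \<in> insert k S" "j' \<in> insert k J - insert k S" "0 < M i' j'" by blast
        have j': "j' \<in> J - S" using ij' by auto
        show ?thesis
        proof (cases "j = k")
          case jk: True
          show ?thesis
          proof (cases "i' = k")
            case True
            then have "0 < M' i j'" using pos2[of i j'] ij ij' j' jk S by auto
            then show ?thesis using ij j' by blast
          next
            case False
            then have "0 < M' i' j'" using pos1[of i' j'] ij' j' S by auto
            then show ?thesis using False ij' j' by blast
          qed
        next
          case False
          then have "0 < M' i j" using pos1[of i j] ij S by auto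
          then show ?thesis using ij False by blast
        qed
      qed
      have "(\<Sum>i\<in>J. M i k * b k / d) = (\<Sum>i\<in>J. M k i * b k / d)"
        using sym by (intro sum.cong) auto
      also have "\<dots> = (\<Sum>i\<in>J. M k i) * b k / d"
        by (simp add: sum_distrib_right sum_divide_distrib)
      also have "\<dots> = b k" using d by (simp add: d_def[symmetric])
      finally show "sum b' J = 0"
        using insert.prems(4) insert.hyps by (simp add: b'_def sum.distrib)
    qed
    then obtain z where z: "\<And>i. i \<in> J \<Longrightarrow> (\<Sum>j\<in>J. M' i j * (z i - z j)) = b' i" by blast
    \<comment> \<open>The equation at \<open>k\<close> forces this value.\<close>
    define c where "c = (b k + (\<Sum>j\<in>J. M k j * z j)) / d"
    have c: "d * c = b k + (\<Sum>j\<in>J. M k j * z j)" using d by (simp add: c_def)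
    have row: "(\<Sum>j\<in>J. M k j * (t - z j)) = d * t - (d * c - b k)" for t
    proof -
      have "(\<Sum>j\<in>J. M k j * (t - z j)) = d * t - (\<Sum>j\<in>J. M k j * z j)"
        unfolding d_def by (simp add: right_diff_distrib sum_subtractf sum_distrib_right)
      then show ?thesis using c by simp
    qed
    define y where "y = z(k := c)"
    have yk: "y k = c" and yJ: "\<And>j. j \<in> J \<Longrightarrow> y j = z j"
      using insert.hyps by (auto simp: y_def)
    have "(\<Sum>j\<in>insert k J. M i j * (y i - y j)) = b i" if i: "i \<in> insert k J" for i
    proof (cases "i = k")
      case True
      have "(\<Sum>j\<in>insert k J. M k j * (y k - y j)) = (\<Sum>j\<in>J. M k j * (c - z j))"
        using insert.hyps by (simp add: yk yJ)
      then show ?thesis using row[of c] True by simp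
    next
      case False
      then have iJ: "i \<in> J" using i by simp
      have "b' i = (\<Sum>j\<in>J. M i j * (z i - z j)) + M i k / d * (\<Sum>j\<in>J. M k j * (z i - z j))"
        unfolding z[OF iJ, symmetric]
        by (simp add: M'_def distrib_right sum.distrib sum_distrib_left mult.assoc)
      also have "(\<Sum>j\<in>J. M k j * (z i - z j)) = d * (z i - c) + b k"
        using row[of "z i"] by (simp add: algebra_simps)
      also have "M i k / d * (d * (z i - c) + b k) = M i k * (z i - c) + M i k * b k / d"
        using d by (simp add: field_simps)
      finally have "b i = (\<Sum>j\<in>J. M i j * (z i - z j)) + M i k * (z i - c)"
        by (simp add: b'_def)
      then show ?thesis using insert.hyps iJ by (simp add: yk yJ)
    qed
    then show ?thesis by blast
  qed
qed

text \<open>Summation by parts: exchanging \<open>i\<close> and \<open>j\<close> and averaging gives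
  the Dirichlet energy. Nonnegative weights thus make a solution pair nonnegatively with its
  right-hand side.\<close>

lemma laplacian_form:
  fixes M :: "'i \<Rightarrow> 'i \<Rightarrow> real"
  assumes "\<And>i j. i \<in> I \<Longrightarrow> j \<in> I \<Longrightarrow> M i j = M j i"
  shows "2 * (\<Sum>i\<in>I. z i * (\<Sum>j\<in>I. M i j * (z i - z j))) = (\<Sum>i\<in>I. \<Sum>j\<in>I. M i j * (z i - z j)\<^sup>2)"
proof -
  have "(\<Sum>i\<in>I. z i * (\<Sum>j\<in>I. M i j * (z i - z j))) = (\<Sum>i\<in>I. \<Sum>j\<in>I. M i j * z i * (z i - z j))"
    by (simp add: sum_distrib_left mult_ac)
  moreover have "\<dots> = (\<Sum>i\<in>I. \<Sum>j\<in>I. M i j * z j * (z j - z i))"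
    using assms by (subst sum.swap) (auto intro!: sum.cong)
  ultimately have "2 * (\<Sum>i\<in>I. z i * (\<Sum>j\<in>I. M i j * (z i - z j)))
      = (\<Sum>i\<in>I. \<Sum>j\<in>I. M i j * z i * (z i - z j)) + (\<Sum>i\<in>I. \<Sum>j\<in>I. M i j * z j * (z j - z i))"
    by simp
  also have "\<dots> = (\<Sum>i\<in>I. \<Sum>j\<in>I. M i j * (z i - z j)\<^sup>2)"
    unfolding sum.distrib[symmetric] by (intro sum.cong refl) (simp add: power2_eq_square algebra_simps)
  finally show ?thesis .
qed

text \<open>The second elementary symmetric form has one positive direction. Since
  \<open>(a, b, c)\<close> is positive for it, the form is negative definite on the complement given
  by \<open>orth\<close>; eliminating \<open>p\<close> exhibits minus a sum of squares.\<close>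

lemma e2_hyperbolic:
  fixes a b c p q u :: real
  assumes "0 \<le> a" "0 \<le> b" "0 \<le> c" and pos: "0 < a * b + b * c + c * a"
    and orth: "p * (b + c) + q * (c + a) + u * (a + b) = 0"
  shows "p * q + q * u + u * p \<le> 0"
    and "p * q + q * u + u * p = 0 \<Longrightarrow> p = 0 \<and> q = 0 \<and> u = 0"
proof -
  have bc: "0 < b + c"
  proof (rule ccontr)
    assume "\<not> 0 < b + c"
    then have "b = 0" "c = 0" using assms by auto
    then show False using pos by simp
  qed
  have "(b + c) * (p * q + q * u + u * p)
      = (q + u) * (p * (b + c) + q * (c + a) + u * (a + b)) - (a * (q + u)\<^sup>2 + c * q\<^sup>2 + b * u\<^sup>2)"
    by (simp add: power2_eq_square algebra_simps)
  then have eq: "(b + c) * (p * q + q * u + u * p) = - (a * (q + u)\<^sup>2 + c * q\<^sup>2 + b * u\<^sup>2)"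
    using orth by simp
  have nn: "0 \<le> a * (q + u)\<^sup>2" "0 \<le> c * q\<^sup>2" "0 \<le> b * u\<^sup>2" using assms by simp_all
  show "p * q + q * u + u * p \<le> 0"
  proof -
    have "(b + c) * (p * q + q * u + u * p) \<le> 0" using eq nn by linarith
    then show ?thesis using bc by (simp add: mult_le_0_iff)
  qed
  assume "p * q + q * u + u * p = 0"
  then have "a * (q + u)\<^sup>2 + c * q\<^sup>2 + b * u\<^sup>2 = 0" using eq by simp
  then have z: "a * (q + u)\<^sup>2 = 0" "c * q\<^sup>2 = 0" "b * u\<^sup>2 = 0" using nn by linarith+
  \<comment> \<open>\<open>pos\<close> leaves at most one of the weights zero, and any two of the
    squares already determine \<open>q\<close> and \<open>u\<close>.\<close>
  have "q = 0 \<and> u = 0"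
  proof -
    consider "b = 0" "a \<noteq> 0" "c \<noteq> 0" | "c = 0" "a \<noteq> 0" "b \<noteq> 0" | "b \<noteq> 0" "c \<noteq> 0"
      using pos by (cases "b = 0"; cases "c = 0"; cases "a = 0") auto
    then show ?thesis using z by cases auto
  qed
  then show "p = 0 \<and> q = 0 \<and> u = 0" using orth bc by auto
qed

section \<open>The quadratic form of a matroid\<close>

text \<open>In \<open>three_classes\<close> the map \<open>c\<close> numbers the parallel classes of a contraction of rank two.\<close>

locale three_class_matroid =
  fixes E :: "'e set" and \<I> :: "'e set set" and r :: nat
  assumes finite_E: "finite E"
    and indep_subset_E: "B \<in> \<I> \<Longrightarrow> B \<subseteq> E"
    and indep_mono: "B \<in> \<I> \<Longrightarrow> A \<subseteq> B \<Longrightarrow> A \<in> \<I>"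
    and augment: "A \<in> \<I> \<Longrightarrow> B \<in> \<I> \<Longrightarrow> card A < card B \<Longrightarrow> \<exists>e\<in>B - A. insert e A \<in> \<I>"
    and base_exists: "\<exists>B\<in>\<I>. card B = r"
    and indep_card_le: "B \<in> \<I> \<Longrightarrow> card B \<le> r"
    and rank_ge_2: "2 \<le> r"
    and three_classes: "A \<in> \<I> \<Longrightarrow> card A + 2 = r \<Longrightarrow> \<exists>c :: 'e \<Rightarrow> nat.
      (\<forall>e\<in>E - A. insert e A \<in> \<I> \<longrightarrow> c e < 3) \<and>
      (\<forall>e\<in>E - A. \<forall>f\<in>E - A. insert e A \<in> \<I> \<longrightarrow> insert f A \<in> \<I> \<longrightarrow> e \<noteq> f \<longrightarrow>
        (insert e (insert f A) \<in> \<I> \<longleftrightarrow> c e \<noteq> c f))"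
begin

definition nonloops :: "'e set \<Rightarrow> 'e set" where
  "nonloops A = {e \<in> E - A. insert e A \<in> \<I>}"

text \<open>For independent \<open>A\<close>, the sets \<open>B - A\<close> are the independent sets
  of the contraction by \<open>A\<close>. Keeping \<open>A\<close> inside lets all contractions
  share the family \<open>\<I>\<close>.\<close>

definition above :: "'e set \<Rightarrow> nat \<Rightarrow> 'e set set" where
  "above A k = {B \<in> \<I>. A \<subseteq> B \<and> card B = k}"

definition class_map :: "'e set \<Rightarrow> ('e \<Rightarrow> nat) \<Rightarrow> bool" where
  "class_map A c \<longleftrightarrow> (\<forall>e\<in>nonloops A. c e < 3) \<and>
     (\<forall>e\<in>nonloops A. \<forall>f\<in>nonloops A. e \<noteq> f \<longrightarrow> (insert e (insert f A) \<in> \<I> \<longleftrightarrow> c e \<noteq> c f))"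

text \<open>\<open>quad A\<close> is the polarised second derivative, at \<open>x\<^sub>0 = 0\<close> and all edge variables \<open>1\<close>, of
  \<open>f\<^sub>r + x\<^sub>0 f\<^bsub>r-1\<^esub> + 3/4 x\<^sub>0\<^sup>2 f\<^bsub>r-2\<^esub>\<close> for the contraction by \<open>A\<close>. Its pairing with the edge \<open>g\<close>
  is \<open>grad A x0 x g\<close>.\<close>

definition quad :: "'e set \<Rightarrow> real \<Rightarrow> ('e \<Rightarrow> real) \<Rightarrow> real \<Rightarrow> ('e \<Rightarrow> real) \<Rightarrow> real" where
  "quad A x0 x y0 y =
     (\<Sum>B\<in>above A r. sum x (B - A) * sum y (B - A) - (\<Sum>e\<in>B - A. x e * y e))
     + (\<Sum>B\<in>above A (r - 1). x0 * sum y (B - A) + y0 * sum x (B - A))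
     + 3 / 2 * x0 * y0 * real (card (above A (r - 2)))"

definition grad :: "'e set \<Rightarrow> real \<Rightarrow> ('e \<Rightarrow> real) \<Rightarrow> 'e \<Rightarrow> real" where
  "grad A x0 x g = (\<Sum>B\<in>above (insert g A) r. sum x (B - insert g A))
     + x0 * real (card (above (insert g A) (r - 1)))"

text \<open>Mixed second derivatives of the basis generating polynomial of the contraction by
  \<open>A\<close>, read below as edge weights of a graph on \<open>nonloops A\<close>.\<close>

definition hess :: "'e set \<Rightarrow> 'e \<Rightarrow> 'e \<Rightarrow> real" where
  "hess A g f = (if g = f then 0 else real (card (above (insert g (insert f A)) r)))"

lemma ex_class_map:
  assumes "A \<in> \<I>" "card A + 2 = r"
  shows "\<exists>c. class_map A c"
  using three_classes[OF assms] unfolding class_map_def nonloops_def by blast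

section \<open>Independent sets above a fixed one, and double counting\<close>

lemma finite_indep: "B \<in> \<I> \<Longrightarrow> finite B"
  using indep_subset_E finite_E finite_subset by blast

lemma finite_\<I>: "finite \<I>"
  using indep_subset_E finite_E by (metis PowI finite_Pow_iff finite_subset subsetI)

lemma finite_above [simp]: "finite (above A k)"
  using finite_\<I> by (simp add: above_def)

lemma finite_nonloops [simp]: "finite (nonloops A)"
  using finite_E by (simp add: nonloops_def)

lemma extend_indep:
  assumes "A \<in> \<I>" "card A \<le> k" "k \<le> r"
  shows "above A k \<noteq> {}"
proof -
  have "\<exists>B\<in>\<I>. A \<subseteq> B \<and> card B = k"
    using assms(2,3)
  proof (induction k rule: dec_induct)
    case base
    then show ?case using assms by auto
  next
    case (step n)
    then obtain B where B: "B \<in> \<I>" "A \<subseteq> B" "card B = n" by auto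
    obtain T where T: "T \<in> \<I>" "card T = r" using base_exists by blast
    obtain e where e: "e \<in> T - B" "insert e B \<in> \<I>"
      using augment[OF B(1) T(1)] B T step.prems by auto
    then have "card (insert e B) = Suc n" using B finite_indep by simp
    then show ?case using B e by (intro bexI[of _ "insert e B"]) auto
  qed
  then show ?thesis by (auto simp: above_def)
qed

lemma card_above_pos:
  assumes "A \<in> \<I>" "card A \<le> k" "k \<le> r"
  shows "0 < card (above A k)"
  using extend_indep[OF assms] by (simp add: card_gt_0_iff)

lemma nonloopsD:
  assumes "g \<in> nonloops A" "A \<in> \<I>"
  shows "g \<in> E" "g \<notin> A" "insert g A \<in> \<I>" "card (insert g A) = Suc (card A)"
  using assms finite_indep by (auto simp: nonloops_def)

lemma above_Diff: "B \<in> above A k \<Longrightarrow> B - A = {g \<in> nonloops A. g \<in> B}"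
  using indep_subset_E indep_mono unfolding above_def nonloops_def
  by (auto intro: indep_mono[of B])

lemma above_insert: "above (insert g A) k = {B \<in> above A k. g \<in> B}"
  by (auto simp: above_def)

lemma card_above_Diff:
  assumes "B \<in> above A k" "A \<in> \<I>"
  shows "card (B - A) + card A = k" "finite (B - A)"
proof -
  have B: "B \<in> \<I>" "A \<subseteq> B" "card B = k" using assms by (auto simp: above_def)
  then have "finite B" using finite_indep by blast
  then show "card (B - A) + card A = k" "finite (B - A)"
    using B card_Diff_subset[of A B] card_mono[of B A] finite_indep[OF assms(2)] by auto
qed

lemma above_not_indep:
  assumes "X \<notin> \<I>"
  shows "above X k = {}"
  using assms indep_mono by (auto simp: above_def)

text \<open>Double counting of the pairs \<open>(B, g)\<close> with \<open>g \<in> B - A\<close>: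
  sums over independent sets become sums over contractions by one more element.\<close>

lemma sum_above_swap:
  fixes h :: "'e set \<Rightarrow> 'e \<Rightarrow> real"
  shows "(\<Sum>B\<in>above A k. \<Sum>g\<in>B - A. h B g) = (\<Sum>g\<in>nonloops A. \<Sum>B\<in>above (insert g A) k. h B g)"
proof -
  have "(\<Sum>B\<in>above A k. \<Sum>g\<in>B - A. h B g)
      = (\<Sum>B\<in>above A k. \<Sum>g\<in>{g \<in> nonloops A. g \<in> B}. h B g)"
    by (intro sum.cong) (auto simp: above_Diff)
  also have "\<dots> = (\<Sum>g\<in>nonloops A. \<Sum>B\<in>{B \<in> above A k. g \<in> B}. h B g)"
    by (rule sum.swap_restrict) simp_all
  finally show ?thesis by (simp add: above_insert)
qed

section \<open>Polarisation and Euler identities for the form\<close>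

lemma quad_add:
  "quad A x0 (\<lambda>e. x e + z e) x0 (\<lambda>e. x e + z e)
     = quad A x0 x x0 x + 2 * quad A x0 x 0 z + quad A 0 z 0 z"
  unfolding quad_def
  by (simp add: sum.distrib sum_subtractf algebra_simps sum_distrib_left)

lemma quad_scale:
  "quad A x0 x 0 (\<lambda>e. s * y e) = s * quad A x0 x 0 y"
  "quad A 0 (\<lambda>e. s * y e) 0 z = s * quad A 0 y 0 z"
  unfolding quad_def
  by (simp_all add: sum_distrib_left[symmetric] sum_subtractf algebra_simps)

lemma quad_eq_grad: "quad A x0 x 0 y = (\<Sum>g\<in>nonloops A. y g * grad A x0 x g)"
proof -
  \<comment> \<open>Removing the diagonal leaves ordered pairs of distinct elements, so each
    \<open>y g\<close> is paired with \<open>x\<close> on \<open>B\<close> without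
    \<open>g\<close>.\<close>
  have 1: "sum x (B - A) * sum y (B - A) - (\<Sum>e\<in>B - A. x e * y e)
      = (\<Sum>g\<in>B - A. y g * sum x (B - insert g A))" if "B \<in> above A r" for B
  proof -
    have fin: "finite (B - A)" using that finite_indep by (auto simp: above_def)
    have "sum x (B - insert g A) = sum x (B - A) - x g" if "g \<in> B - A" for g
      using sum_diff1[OF fin, of x g] that by (metis Diff_insert)
    then show ?thesis
      by (simp add: right_diff_distrib sum_subtractf sum_distrib_left[symmetric]
          sum_distrib_right[symmetric] mult.commute)
  qed
  have "quad A x0 x 0 y = (\<Sum>B\<in>above A r. \<Sum>g\<in>B - A. y g * sum x (B - insert g A))
      + (\<Sum>B\<in>above A (r - 1). \<Sum>g\<in>B - A. x0 * y g)"
    unfolding quad_def using 1 by (simp add: sum_distrib_left)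
  also have "\<dots> = (\<Sum>g\<in>nonloops A. y g * grad A x0 x g)"
  proof -
    have 2: "(\<Sum>B\<in>above A r. \<Sum>g\<in>B - A. y g * sum x (B - insert g A))
        = (\<Sum>g\<in>nonloops A. \<Sum>B\<in>above (insert g A) r. y g * sum x (B - insert g A))"
      by (rule sum_above_swap)
    have 3: "(\<Sum>B\<in>above A (r - 1). \<Sum>g\<in>B - A. x0 * y g)
        = (\<Sum>g\<in>nonloops A. \<Sum>B\<in>above (insert g A) (r - 1). x0 * y g)"
      by (rule sum_above_swap)
    show ?thesis
      unfolding 2 3 grad_def sum.distrib[symmetric]
      by (intro sum.cong) (simp_all add: sum_distrib_left[symmetric] algebra_simps)
  qed
  finally show ?thesis .
qed

text \<open>Euler's identity for a first derivative of the polynomial of the contraction by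
  \<open>insert g A\<close>: that derivative is homogeneous of degree \<open>d - 2\<close>.\<close>

lemma quad_insert_one:
  assumes "A \<in> \<I>" "g \<in> nonloops A" "card A + d = r" "2 \<le> d"
  shows "quad (insert g A) x0 x 0 (\<lambda>_. 1) = (real d - 2) * grad A x0 x g"
proof -
  note g = nonloopsD[OF assms(2,1)]
  have c1: "real (card (B - insert g A)) = real d - 1" if "B \<in> above (insert g A) r" for B
    using card_above_Diff(1)[OF that g(3)] g(4) assms by linarith
  have c2: "real (card (B - insert g A)) = real d - 2" if "B \<in> above (insert g A) (r - 1)" for B
    using card_above_Diff(1)[OF that g(3)] g(4) assms by linarith
  have "quad (insert g A) x0 x 0 (\<lambda>_. 1)
      = (\<Sum>B\<in>above (insert g A) r. (real d - 2) * sum x (B - insert g A))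
        + (\<Sum>B\<in>above (insert g A) (r - 1). x0 * (real d - 2))"
  proof -
    have "(\<Sum>B\<in>above (insert g A) r. sum x (B - insert g A) * (\<Sum>e\<in>B - insert g A. 1) - (\<Sum>e\<in>B - insert g A. x e * 1))
        = (\<Sum>B\<in>above (insert g A) r. (real d - 2) * sum x (B - insert g A))"
      by (intro sum.cong) (simp_all add: c1 algebra_simps)
    moreover have "(\<Sum>B\<in>above (insert g A) (r - 1). x0 * (\<Sum>e\<in>B - insert g A. 1) + 0 * sum x (B - insert g A))
        = (\<Sum>B\<in>above (insert g A) (r - 1). x0 * (real d - 2))"
      by (intro sum.cong) (simp_all add: c2)
    ultimately show ?thesis unfolding quad_def by simp
  qed
  also have "\<dots> = (real d - 2) * grad A x0 x g"
    unfolding grad_def by (simp add: sum_distrib_left[symmetric] distrib_left mult_ac)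
  finally show ?thesis .
qed

text \<open>An ordered pair of distinct elements of \<open>S\<close> survives the deletion of
  \<open>card S - 2\<close> elements \<open>g\<close>, and a single element survives
  \<open>card S - 1\<close> deletions.\<close>

lemma sum_delete_products:
  fixes x y :: "'e \<Rightarrow> real"
  assumes "finite S"
  shows "(\<Sum>g\<in>S. sum x (S - {g}) * sum y (S - {g}) - (\<Sum>e\<in>S - {g}. x e * y e))
      = (real (card S) - 2) * (sum x S * sum y S - (\<Sum>e\<in>S. x e * y e))"
    and "(\<Sum>g\<in>S. sum x (S - {g})) = (real (card S) - 1) * sum x S"
proof -
  have d: "sum h (S - {g}) = sum h S - h g" if "g \<in> S" for h :: "'e \<Rightarrow> real" and g
    using sum_diff1[OF assms, of h g] that by simp
  have "(\<Sum>g\<in>S. sum x (S - {g}) * sum y (S - {g}) - (\<Sum>e\<in>S - {g}. x e * y e))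
      = (\<Sum>g\<in>S. (sum x S - x g) * (sum y S - y g) - ((\<Sum>e\<in>S. x e * y e) - x g * y g))"
    by (intro sum.cong) (simp_all add: d)
  also have "\<dots> = (\<Sum>g\<in>S. sum x S * sum y S - (\<Sum>e\<in>S. x e * y e))
      - sum y S * (\<Sum>g\<in>S. x g) - sum x S * (\<Sum>g\<in>S. y g) + 2 * (\<Sum>g\<in>S. x g * y g)"
  proof -
    have "(\<Sum>g\<in>S. (X - x g) * (Y - y g) - (P - x g * y g))
        = (\<Sum>g\<in>S. X * Y - P) - Y * (\<Sum>g\<in>S. x g) - X * (\<Sum>g\<in>S. y g) + 2 * (\<Sum>g\<in>S. x g * y g)"
      for X Y P :: real
      unfolding sum_distrib_left sum.distrib[symmetric] sum_subtractf[symmetric]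
      by (intro sum.cong) (simp_all add: algebra_simps)
    then show ?thesis .
  qed
  also have "\<dots> = (real (card S) - 2) * (sum x S * sum y S - (\<Sum>e\<in>S. x e * y e))"
    by (simp add: algebra_simps)
  finally show "(\<Sum>g\<in>S. sum x (S - {g}) * sum y (S - {g}) - (\<Sum>e\<in>S - {g}. x e * y e))
      = (real (card S) - 2) * (sum x S * sum y S - (\<Sum>e\<in>S. x e * y e))" .
  have "(\<Sum>g\<in>S. sum x (S - {g})) = (\<Sum>g\<in>S. sum x S - x g)"
    by (intro sum.cong) (simp_all add: d)
  then show "(\<Sum>g\<in>S. sum x (S - {g})) = (real (card S) - 1) * sum x S"
    by (simp add: sum_subtractf algebra_simps)
qed

text \<open>Euler's identity for the second derivatives, which have degree \<open>d - 2\<close>. It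
  lets bounds on the forms of the contractions by one more element be summed to a bound for
  \<open>A\<close>.\<close>

lemma sum_quad_insert:
  assumes "A \<in> \<I>" "card A + d = r" "2 \<le> d"
  shows "(\<Sum>g\<in>nonloops A. quad (insert g A) x0 x y0 y) = (real d - 2) * quad A x0 x y0 y"
proof -
  let ?q = "\<lambda>S. sum x S * sum y S - (\<Sum>e\<in>S. x e * y e)"
  let ?l = "\<lambda>S. x0 * sum y S + y0 * sum x S"
  have D: "B - insert g A = (B - A) - {g}" for B g by auto
  have c: "real (card (B - A)) = real d - j" "finite (B - A)"
    if "B \<in> above A (r - j)" "j \<le> 2" for B j
    using card_above_Diff[OF that(1) assms(1)] that(2) assms(2,3) by linarith+
  \<comment> \<open>All three terms get the same factor: pairs in sets of size \<open>d\<close>,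
    single elements in sets of size \<open>d - 1\<close>, and the empty choice in sets of size
    \<open>d - 2\<close> each survive \<open>d - 2\<close> deletions.\<close>
  have 1: "(\<Sum>g\<in>nonloops A. \<Sum>B\<in>above (insert g A) r. ?q (B - insert g A))
      = (real d - 2) * (\<Sum>B\<in>above A r. ?q (B - A))"
  proof -
    have "(\<Sum>g\<in>(B - A). ?q ((B - A) - {g})) = (real d - 2) * ?q (B - A)" if "B \<in> above A r" for B
      using sum_delete_products(1)[of "B - A" x y] c[of B 0] that by simp
    then show ?thesis
      unfolding sum_above_swap[symmetric] D by (simp add: sum_distrib_left[symmetric])
  qed
  have 2: "(\<Sum>g\<in>nonloops A. \<Sum>B\<in>above (insert g A) (r - 1). ?l (B - insert g A))
      = (real d - 2) * (\<Sum>B\<in>above A (r - 1). ?l (B - A))"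
  proof -
    have "(\<Sum>g\<in>(B - A). ?l ((B - A) - {g})) = (real d - 2) * ?l (B - A)" if "B \<in> above A (r - 1)" for B
    proof -
      have "real (card (B - A)) = real d - 1" "finite (B - A)" using c[of B 1] that by auto
      then have del: "(\<Sum>g\<in>B - A. sum h (B - A - {g})) = (real d - 2) * sum h (B - A)"
        for h :: "'e \<Rightarrow> real"
        using sum_delete_products(2)[of "B - A" h] by simp
      show ?thesis
        unfolding sum.distrib sum_distrib_left[symmetric] del by (simp add: algebra_simps)
    qed
    then show ?thesis
      unfolding sum_above_swap[symmetric] D by (simp add: sum_distrib_left[symmetric])
  qed
  have 3: "(\<Sum>g\<in>nonloops A. real (card (above (insert g A) (r - 2))))
      = (real d - 2) * real (card (above A (r - 2)))"
  proof -
    have "(\<Sum>g\<in>nonloops A. real (card (above (insert g A) (r - 2))))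
        = (\<Sum>B\<in>above A (r - 2). \<Sum>g\<in>B - A. 1)"
      unfolding sum_above_swap by simp
    also have "\<dots> = (\<Sum>B\<in>above A (r - 2). real d - 2)"
      using c[of _ 2] by (intro sum.cong) auto
    finally show ?thesis by simp
  qed
  define a b n where "a g = (\<Sum>B\<in>above (insert g A) r. ?q (B - insert g A))"
    and "b g = (\<Sum>B\<in>above (insert g A) (r - 1). ?l (B - insert g A))"
    and "n g = real (card (above (insert g A) (r - 2)))" for g
  have "(\<Sum>g\<in>nonloops A. quad (insert g A) x0 x y0 y)
      = (\<Sum>g\<in>nonloops A. a g + b g + 3 / 2 * x0 * y0 * n g)"
    by (simp add: quad_def a_def b_def n_def)
  also have "\<dots> = sum a (nonloops A) + sum b (nonloops A) + 3 / 2 * x0 * y0 * sum n (nonloops A)"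
    by (simp add: sum.distrib sum_distrib_left)
  also have "\<dots> = (real d - 2) * quad A x0 x y0 y"
    unfolding quad_def distrib_left 1[folded a_def] 2[folded b_def] 3[folded n_def] by simp
  finally show ?thesis .
qed

section \<open>The gradient and the weighted graph of second derivatives\<close>

lemma grad_add: "grad A x0 (\<lambda>e. x e + z e) g = grad A x0 x g + grad A 0 z g"
  by (simp add: grad_def sum.distrib)

lemma grad_linear:
  assumes "g \<in> nonloops A" "A \<in> \<I>"
  shows "grad A 0 z g = (\<Sum>f\<in>nonloops A. hess A g f * z f)"
proof -
  note g = nonloopsD[OF assms]
  have sub: "nonloops (insert g A) \<subseteq> nonloops A - {g}"
    unfolding nonloops_def by (auto intro: indep_mono)
  \<comment> \<open>Such an \<open>f\<close> equals \<open>g\<close>, where \<open>hess\<close> is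
    zero by definition, or is parallel to \<open>g\<close>, so that no independent set contains both
    together with \<open>A\<close>.\<close>
  have zero: "hess A g f = 0" if "f \<in> nonloops A - nonloops (insert g A)" for f
  proof (cases "f = g")
    case False
    then have "insert f (insert g A) \<notin> \<I>" using that by (auto simp: nonloops_def)
    then show ?thesis by (simp add: hess_def above_not_indep insert_commute)
  qed (simp add: hess_def)
  have "grad A 0 z g = (\<Sum>B\<in>above (insert g A) r. \<Sum>f\<in>B - insert g A. z f)"
    by (simp add: grad_def)
  also have "\<dots> = (\<Sum>f\<in>nonloops (insert g A). hess A g f * z f)"
    unfolding sum_above_swap using sub
    by (intro sum.cong) (auto simp: hess_def insert_commute)
  also have "\<dots> = (\<Sum>f\<in>nonloops A. hess A g f * z f)"
    using sub zero by (intro sum.mono_neutral_left) auto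
  finally show ?thesis .
qed

lemma grad_one:
  assumes "g \<in> nonloops A" "A \<in> \<I>" "card A + d = r"
  shows "grad A 0 (\<lambda>_. 1) g = (real d - 1) * real (card (above (insert g A) r))"
proof -
  note g = nonloopsD[OF assms(1,2)]
  have "real (card (B - insert g A)) = real d - 1" if "B \<in> above (insert g A) r" for B
    using card_above_Diff(1)[OF that g(3)] g(4) assms by linarith
  then show ?thesis by (simp add: grad_def)
qed

lemma hess_sym: "hess A e f = hess A f e"
  by (simp add: hess_def insert_commute)

lemma hess_nonneg: "0 \<le> hess A e f"
  by (simp add: hess_def)

lemma hess_pos:
  assumes "e \<noteq> f" "insert e (insert f A) \<in> \<I>"
  shows "0 < hess A e f"
  using assms card_above_pos[of "insert e (insert f A)" r] indep_card_le by (simp add: hess_def)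

text \<open>In rank at least two, non-parallel elements are adjacent and parallel ones have a common
  neighbour, so every cut is crossed. This is the solvability condition of
  \<open>laplacian_solvable\<close>.\<close>

lemma hess_connected:
  assumes A: "A \<in> \<I>" "card A + 2 \<le> r" and S: "S \<subseteq> nonloops A" "S \<noteq> {}" "S \<noteq> nonloops A"
  shows "\<exists>e\<in>S. \<exists>f\<in>nonloops A - S. 0 < hess A e f"
proof -
  obtain e f where e: "e \<in> S" and f: "f \<in> nonloops A" "f \<notin> S" using S by blast
  have eA: "e \<in> nonloops A" using e S by auto
  note e' = nonloopsD[OF eA A(1)] and f' = nonloopsD[OF f(1) A(1)]
  show ?thesis
  proof (cases "insert e (insert f A) \<in> \<I>")
    case True
    then show ?thesis using hess_pos[of e f A] e f by blast
  next
    case False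
    \<comment> \<open>Augmenting \<open>insert f A\<close> from an independent set that contains
      \<open>e\<close> yields \<open>g\<close>, which is adjacent to both \<open>e\<close> and
      \<open>f\<close>.\<close>
    obtain T where T: "T \<in> above (insert e A) (card A + 2)"
      using extend_indep[OF e'(3), of "card A + 2"] e'(4) A(2) by auto
    then have T': "T \<in> \<I>" "insert e A \<subseteq> T" "card T = card A + 2" by (auto simp: above_def)
    obtain g where g: "g \<in> T - insert f A" "insert g (insert f A) \<in> \<I>"
      using augment[OF f'(3) T'(1)] f'(4) T' by auto
    have ge: "g \<noteq> e" using g False by auto
    have gA: "g \<in> nonloops A"
      using g indep_subset_E indep_mono[OF g(2), of "insert g A"] by (fastforce simp: nonloops_def)
    have eg: "insert e (insert g A) \<in> \<I>" using T' g by (auto intro: indep_mono[OF T'(1)])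
    show ?thesis
    proof (cases "g \<in> S")
      case True
      have "0 < hess A g f" using hess_pos[of g f A] g by auto
      then show ?thesis using True f by blast
    next
      case False
      have "0 < hess A e g" using hess_pos[of e g A] ge eg by auto
      then show ?thesis using False e gA by blast
    qed
  qed
qed

section \<open>Hyperbolicity and its passage from contractions\<close>

lemma quad_one_pos:
  assumes "A \<in> \<I>" "card A + 2 \<le> r"
  shows "0 < quad A 0 (\<lambda>_. 1) 0 (\<lambda>_. 1)"
proof -
  define d where "d = r - card A"
  have d: "card A + d = r" "2 \<le> d" using assms by (auto simp: d_def)
  have "real (card (B - A)) = d" if "B \<in> above A r" for B
    using card_above_Diff(1)[OF that assms(1)] d by linarith
  then have "quad A 0 (\<lambda>_. 1) 0 (\<lambda>_. 1) = real (card (above A r)) * (real d * (real d - 1))"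
    unfolding quad_def by (simp add: algebra_simps)
  moreover have "0 < card (above A r)" using card_above_pos[OF assms(1), of r] d by simp
  ultimately show ?thesis using d by simp
qed

text \<open>Lorentzian signature: since the all-ones vector is positive by
  \<open>quad_one_pos\<close>, nonpositivity on its orthogonal complement leaves exactly one
  positive direction.\<close>

definition hyperbolic :: "'e set \<Rightarrow> bool" where
  "hyperbolic A \<longleftrightarrow> (\<forall>x0 x. quad A x0 x 0 (\<lambda>_. 1) = 0 \<longrightarrow> quad A x0 x x0 x \<le> 0)"

text \<open>Adding the constant \<open>s = - l / p\<close> projects \<open>x\<close> off the
  all-ones vector; expanding the nonpositive value of the projection gives the bound.\<close>

lemma hyperbolic_reverse_CS:
  assumes "hyperbolic A" "A \<in> \<I>" "card A + 2 \<le> r"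
  shows "quad A x0 x x0 x * quad A 0 (\<lambda>_. 1) 0 (\<lambda>_. 1) \<le> (quad A x0 x 0 (\<lambda>_. 1))\<^sup>2"
proof -
  define p where "p = quad A 0 (\<lambda>_. 1) 0 (\<lambda>_. 1)"
  define l where "l = quad A x0 x 0 (\<lambda>_. 1)"
  define s where "s = - l / p"
  have p: "p > 0" using quad_one_pos assms p_def by simp
  have z1: "quad A x0 x 0 (\<lambda>_. s) = s * l" for s
    using quad_scale(1)[of A x0 x s "\<lambda>_. 1"] by (simp add: l_def)
  have z2: "quad A 0 (\<lambda>_. s) 0 (\<lambda>_. 1) = s * p" for s
    using quad_scale(2)[of A s "\<lambda>_. 1" "\<lambda>_. 1"] by (simp add: p_def)
  have z3: "quad A 0 (\<lambda>_. s) 0 (\<lambda>_. s) = s * (s * p)"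
    using quad_scale(1)[of A 0 "\<lambda>_. s" s "\<lambda>_. 1"] z2 by simp
  have "quad A x0 (\<lambda>e. x e + s) 0 (\<lambda>_. 1) = l + s * p"
    using z2[of s] unfolding l_def quad_eq_grad by (simp add: grad_add sum.distrib)
  also have "\<dots> = 0" using p by (simp add: s_def)
  finally have "quad A x0 (\<lambda>e. x e + s) x0 (\<lambda>e. x e + s) \<le> 0"
    using assms(1) by (simp add: hyperbolic_def)
  then have "quad A x0 x x0 x + 2 * (s * l) + s * (s * p) \<le> 0"
    using quad_add[of A x0 x "\<lambda>_. s"] z1 z3 by simp
  then have "quad A x0 x x0 x - l\<^sup>2 / p \<le> 0"
    using p by (simp add: s_def power2_eq_square)
  then show ?thesis
    using p unfolding p_def[symmetric] l_def[symmetric] by (simp add: field_simps)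
qed

text \<open>The local-to-global step. Reverse Cauchy--Schwarz in the contractions bounds the form at
  \<open>x\<close> by a weighted norm of its gradient; this bound is applied not to \<open>x\<close> but to \<open>x + z\<close>, where
  \<open>z\<close> solves the Laplace equation whose right-hand side is the gradient of \<open>x\<close>.\<close>

lemma hyperbolic_step:
  assumes A: "A \<in> \<I>" "card A + 3 \<le> r"
    and hyp: "\<And>g. g \<in> nonloops A \<Longrightarrow> hyperbolic (insert g A)"
    and orth: "quad A x0 x 0 (\<lambda>_. 1) = 0"
  shows "quad A x0 x x0 x \<le> 0"
    and "quad A x0 x x0 x = 0 \<Longrightarrow> g \<in> nonloops A \<Longrightarrow>
      quad (insert g A) x0 x 0 (\<lambda>_. 1) = 0 \<and> quad (insert g A) x0 x x0 x = 0"
proof -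
  let ?I = "nonloops A"
  define d where "d = r - card A"
  have d: "card A + d = r" "3 \<le> d" using A by (auto simp: d_def)
  \<comment> \<open>\<open>D\<close> is both the weighted degree in the graph of \<open>hess\<close>
    and the gradient of the all-ones vector.\<close>
  define D where "D g = (real d - 1) * real (card (above (insert g A) r))" for g
  have Dpos: "0 < D g" if "g \<in> ?I" for g
    using nonloopsD[OF that A(1)] card_above_pos[of "insert g A" r] d by (simp add: D_def)
  have rowsum: "(\<Sum>f\<in>?I. hess A g f) = D g" if "g \<in> ?I" for g
    using grad_linear[OF that A(1), of "\<lambda>_. 1"] grad_one[OF that A(1) d(1)] by (simp add: D_def)
  \<comment> \<open>By Euler's identity, both pairings with the all-ones vector in the contraction
    are \<open>real d - 2\<close> times gradients for \<open>A\<close>, so one such factor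
    cancels.\<close>
  have local_bound: "quad (insert g A) y0 y y0 y \<le> (real d - 2) * ((grad A y0 y g)\<^sup>2 / D g)"
    if "g \<in> ?I" for g y0 y
  proof -
    note g = nonloopsD[OF that A(1)]
    have "quad (insert g A) y0 y y0 y * quad (insert g A) 0 (\<lambda>_. 1) 0 (\<lambda>_. 1)
        \<le> (quad (insert g A) y0 y 0 (\<lambda>_. 1))\<^sup>2"
      using g A by (intro hyperbolic_reverse_CS hyp that) auto
    moreover have "quad (insert g A) z0 z 0 (\<lambda>_. 1) = (real d - 2) * grad A z0 z g" for z0 z
      using that A d by (intro quad_insert_one) auto
    moreover have "grad A 0 (\<lambda>_. 1) g = D g"
      using grad_one[OF that A(1) d(1)] by (simp add: D_def)
    ultimately have "quad (insert g A) y0 y y0 y * D g * (real d - 2)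
        \<le> (real d - 2) * (grad A y0 y g)\<^sup>2 * (real d - 2)"
      by (simp add: power2_eq_square mult_ac)
    then have "quad (insert g A) y0 y y0 y * D g \<le> (real d - 2) * (grad A y0 y g)\<^sup>2"
      using d by (simp add: mult.commute)
    then have "quad (insert g A) y0 y y0 y \<le> (real d - 2) * (grad A y0 y g)\<^sup>2 / D g"
      using Dpos[OF that] by (simp add: pos_le_divide_eq)
    then show ?thesis by simp
  qed
  have bound: "quad A y0 y y0 y \<le> (\<Sum>g\<in>?I. (grad A y0 y g)\<^sup>2 / D g)" for y0 y
  proof -
    have "(real d - 2) * quad A y0 y y0 y = (\<Sum>g\<in>?I. quad (insert g A) y0 y y0 y)"
      using sum_quad_insert[OF A(1) d(1)] d by simp
    also have "\<dots> \<le> (real d - 2) * (\<Sum>g\<in>?I. (grad A y0 y g)\<^sup>2 / D g)"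
      unfolding sum_distrib_left by (intro sum_mono local_bound)
    finally show ?thesis using d by simp
  qed
  \<comment> \<open>The right-hand side has sum zero, because by \<open>quad_eq_grad\<close> this
    sum is the pairing in \<open>orth\<close>.\<close>
  have "\<exists>z. \<forall>g\<in>?I. (\<Sum>f\<in>?I. hess A g f * (z g - z f)) = grad A x0 x g"
    using A orth
    by (intro laplacian_solvable hess_connected) (auto simp: hess_sym hess_nonneg quad_eq_grad)
  then obtain z where z: "\<And>g. g \<in> ?I \<Longrightarrow> (\<Sum>f\<in>?I. hess A g f * (z g - z f)) = grad A x0 x g"
    by blast
  have gz: "grad A 0 z g = D g * z g - grad A x0 x g" if "g \<in> ?I" for g
    unfolding z[OF that, symmetric] rowsum[OF that, symmetric] grad_linear[OF that A(1)]
    by (simp add: right_diff_distrib sum_subtractf sum_distrib_right)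
  have "quad A x0 (\<lambda>e. x e + z e) x0 (\<lambda>e. x e + z e)
      = quad A x0 x x0 x + (\<Sum>g\<in>?I. z g * grad A x0 x g) + (\<Sum>g\<in>?I. D g * (z g)\<^sup>2)"
  proof -
    have "quad A 0 z 0 z = (\<Sum>g\<in>?I. D g * (z g)\<^sup>2 - z g * grad A x0 x g)"
      unfolding quad_eq_grad
      by (intro sum.cong) (simp_all add: gz power2_eq_square algebra_simps)
    then show ?thesis
      unfolding quad_add by (simp add: quad_eq_grad sum_subtractf)
  qed
  \<comment> \<open>By \<open>gz\<close> the gradient of \<open>x + z\<close> at \<open>g\<close> is
    \<open>D g * z g\<close>. Hence the bound is exactly the last sum of the preceding expansion,
    and the two cancel.\<close>
  moreover have "quad A x0 (\<lambda>e. x e + z e) x0 (\<lambda>e. x e + z e) \<le> (\<Sum>g\<in>?I. D g * (z g)\<^sup>2)"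
  proof -
    have "(\<Sum>g\<in>?I. (grad A x0 (\<lambda>e. x e + z e) g)\<^sup>2 / D g) = (\<Sum>g\<in>?I. D g * (z g)\<^sup>2)"
      using Dpos by (intro sum.cong) (auto simp: grad_add gz power2_eq_square less_imp_neq[symmetric])
    then show ?thesis using bound[of x0 "\<lambda>e. x e + z e"] by simp
  qed
  ultimately have le: "quad A x0 x x0 x \<le> - (\<Sum>g\<in>?I. z g * grad A x0 x g)" by simp
  have form: "2 * (\<Sum>g\<in>?I. z g * grad A x0 x g) = (\<Sum>g\<in>?I. \<Sum>f\<in>?I. hess A g f * (z g - z f)\<^sup>2)"
    using laplacian_form[of ?I "hess A" z] hess_sym z by simp
  have nn: "0 \<le> (\<Sum>f\<in>?I. hess A g f * (z g - z f)\<^sup>2)" for g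
    by (intro sum_nonneg) (simp add: hess_nonneg)
  have "0 \<le> (\<Sum>g\<in>?I. \<Sum>f\<in>?I. hess A g f * (z g - z f)\<^sup>2)"
    by (intro sum_nonneg nn)
  then have "0 \<le> (\<Sum>g\<in>?I. z g * grad A x0 x g)"
    using form by linarith
  then show "quad A x0 x x0 x \<le> 0" using le by simp
  assume eq: "quad A x0 x x0 x = 0" and g: "g \<in> ?I"
  \<comment> \<open>Equality kills the Dirichlet energy, so \<open>z\<close> is constant along edges
    of positive weight and the Laplace equation gives gradient zero. The forms of the contractions
    are then nonpositive with sum zero, so each vanishes.\<close>
  have "(\<Sum>g\<in>?I. \<Sum>f\<in>?I. hess A g f * (z g - z f)\<^sup>2) = 0"
    using form le eq \<open>0 \<le> (\<Sum>g\<in>?I. z g * grad A x0 x g)\<close> by linarith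
  then have "\<forall>g\<in>?I. (\<Sum>f\<in>?I. hess A g f * (z g - z f)\<^sup>2) = 0"
    by (subst (asm) sum_nonneg_eq_0_iff) (auto simp: nn)
  then have "\<forall>g\<in>?I. \<forall>f\<in>?I. hess A g f * (z g - z f)\<^sup>2 = 0"
    by (subst (asm) sum_nonneg_eq_0_iff) (auto simp: hess_nonneg)
  then have "hess A g f * (z g - z f) = 0" if "g \<in> ?I" "f \<in> ?I" for g f using that by auto
  then have grad0: "grad A x0 x g = 0" if "g \<in> ?I" for g
    using z[OF that] that by (simp add: sum.neutral)
  have one: "quad (insert g A) x0 x 0 (\<lambda>_. 1) = 0" if "g \<in> ?I" for g
    using quad_insert_one[OF A(1) that d(1)] d grad0[OF that] by simp
  then have le0: "quad (insert g A) x0 x x0 x \<le> 0" if "g \<in> ?I" for g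
    using hyp[OF that] that by (auto simp: hyperbolic_def)
  have "(\<Sum>g\<in>?I. - quad (insert g A) x0 x x0 x) = 0"
    using sum_quad_insert[OF A(1) d(1), of x0 x x0 x] d eq by (simp add: sum_negf)
  then have "\<forall>g\<in>?I. - quad (insert g A) x0 x x0 x = 0"
    by (subst (asm) sum_nonneg_eq_0_iff) (auto simp: le0)
  then show "quad (insert g A) x0 x 0 (\<lambda>_. 1) = 0 \<and> quad (insert g A) x0 x x0 x = 0"
    using one g by auto
qed

section \<open>Rank two and the induction over contractions\<close>

lemma above_self:
  assumes "A \<in> \<I>"
  shows "above A (card A) = {A}"
proof -
  have "B = A" if "B \<in> \<I>" "A \<subseteq> B" "card B = card A" for B
    using card_subset_eq[OF finite_indep[OF that(1)] that(2)] that(3) by simp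
  then show ?thesis using assms by (auto simp: above_def)
qed

lemma sum_class_map:
  assumes "class_map A c"
  shows "sum h (nonloops A) = sum h {e \<in> nonloops A. c e = 0} + sum h {e \<in> nonloops A. c e = 1}
    + sum h {e \<in> nonloops A. c e = 2}"
proof -
  have "sum h (nonloops A) = (\<Sum>i\<in>{0, 1, 2}. sum h {e \<in> nonloops A. c e = i})"
    using assms by (intro sum.group[symmetric]) (auto simp: class_map_def)
  then show ?thesis by (simp add: add.assoc)
qed

text \<open>In rank two the form is \<open>2 e\<^sub>2(s\<^sub>0 + x\<^sub>0/2, s\<^sub>1 + x\<^sub>0/2, s\<^sub>2 + x\<^sub>0/2)\<close>, where \<open>s\<^sub>i\<close> is the sum of
  \<open>x\<close> over the \<open>i\<close>-th parallel class; this is where the factor \<open>3/2\<close> comes from.\<close>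

lemma quad_rank_two:
  assumes A: "A \<in> \<I>" "card A + 2 = r" and c: "class_map A c"
  defines "s \<equiv> \<lambda>x i. \<Sum>e\<in>{e \<in> nonloops A. c e = i}. x e"
  shows "quad A x0 x 0 y =
      (s x 0 + x0 / 2) * (s y 1 + s y 2) + (s x 1 + x0 / 2) * (s y 2 + s y 0)
      + (s x 2 + x0 / 2) * (s y 0 + s y 1)"
    and "quad A x0 x x0 x =
      2 * ((s x 0 + x0 / 2) * (s x 1 + x0 / 2) + (s x 1 + x0 / 2) * (s x 2 + x0 / 2)
      + (s x 2 + x0 / 2) * (s x 0 + x0 / 2))"
proof -
  let ?I = "nonloops A"
  \<comment> \<open>A base is \<open>A\<close> with two elements of different classes, so
    \<open>hess\<close> is the adjacency matrix of a complete multipartite graph.\<close>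
  have hess: "hess A g f = (if c g \<noteq> c f then 1 else 0)" if "g \<in> ?I" "f \<in> ?I" for g f
  proof (cases "g \<noteq> f \<and> c g \<noteq> c f")
    case True
    then have ind: "insert g (insert f A) \<in> \<I>" using c that by (auto simp: class_map_def)
    have "g \<notin> A" "f \<notin> A" using that nonloopsD A by blast+
    then have "card (insert g (insert f A)) = r"
      using True A finite_indep[OF A(1)] by simp
    then show ?thesis using True above_self[OF ind] by (simp add: hess_def)
  next
    case False
    then have "g = f \<or> insert g (insert f A) \<notin> \<I>" using c that by (auto simp: class_map_def)
    then show ?thesis using False by (auto simp: hess_def above_not_indep)
  qed
  have single: "above (insert g A) (r - 1) = {insert g A}" if "g \<in> ?I" for g
  proof -
    have "card (insert g A) = r - 1" using nonloopsD[OF that A(1)] A(2) by simp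
    then show ?thesis using above_self nonloopsD(3)[OF that A(1)] by metis
  qed
  have grad: "grad A x0 x g = s x 0 + s x 1 + s x 2 - s x (c g) + x0" if "g \<in> ?I" for g x0 x
  proof -
    have "grad A x0 x g = grad A 0 x g + x0"
      using single[OF that] by (simp add: grad_def)
    also have "grad A 0 x g = (\<Sum>f\<in>?I. x f - (if c f = c g then x f else 0))"
      unfolding grad_linear[OF that A(1)] by (intro sum.cong) (auto simp: hess that)
    also have "\<dots> = sum x ?I - s x (c g)"
      by (simp add: sum_subtractf s_def sum.inter_filter)
    finally show ?thesis using sum_class_map[OF c, of x] by (simp add: s_def)
  qed
  have lin: "quad A x0 x 0 y = (s x 1 + s x 2 + x0) * s y 0 + (s x 0 + s x 2 + x0) * s y 1
      + (s x 0 + s x 1 + x0) * s y 2" for x0 x y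
  proof -
    have part: "(\<Sum>g\<in>{e \<in> ?I. c e = i}. y g * grad A x0 x g)
        = (s x 0 + s x 1 + s x 2 - s x i + x0) * s y i" for i
      unfolding s_def sum_distrib_left
      by (intro sum.cong) (auto simp: grad s_def)
    show ?thesis
      unfolding quad_eq_grad sum_class_map[OF c] part by simp
  qed
  show "quad A x0 x 0 y =
      (s x 0 + x0 / 2) * (s y 1 + s y 2) + (s x 1 + x0 / 2) * (s y 2 + s y 0)
      + (s x 2 + x0 / 2) * (s y 0 + s y 1)"
    unfolding lin by (simp add: algebra_simps)
  \<comment> \<open>The pure \<open>x0\<close> term \<open>3 / 2 * x0 * x0\<close> is twice the
    second symmetric form at three entries \<open>x0 / 2\<close>, which completes the shift.\<close>
  have "quad A x0 x x0 x = quad A 0 x 0 x + 2 * quad A x0 (\<lambda>_. 0) 0 x + 3 / 2 * x0 * x0"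
  proof -
    have "above A (r - 2) = {A}" using above_self[OF A(1)] A(2) by (simp flip: A(2))
    then have "quad A x0 (\<lambda>_. 0) x0 (\<lambda>_. 0) = 3 / 2 * x0 * x0" by (simp add: quad_def)
    then show ?thesis using quad_add[of A x0 "\<lambda>_. 0" x] by simp
  qed
  also have "\<dots> = 2 * ((s x 0 + x0 / 2) * (s x 1 + x0 / 2) + (s x 1 + x0 / 2) * (s x 2 + x0 / 2)
      + (s x 2 + x0 / 2) * (s x 0 + x0 / 2))"
    unfolding lin by (simp add: s_def algebra_simps)
  finally show "quad A x0 x x0 x =
      2 * ((s x 0 + x0 / 2) * (s x 1 + x0 / 2) + (s x 1 + x0 / 2) * (s x 2 + x0 / 2)
      + (s x 2 + x0 / 2) * (s x 0 + x0 / 2))" .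
qed

text \<open>An instance of \<open>e2_hyperbolic\<close>: the class sizes \<open>n i\<close> form the
  positive vector, and the shifted class sums \<open>p i\<close> are orthogonal to it. Definiteness
  makes all \<open>p i\<close> vanish in the equality case.\<close>

lemma hyperbolic_rank_two:
  assumes A: "A \<in> \<I>" "card A + 2 = r" and c: "class_map A c"
    and orth: "quad A x0 x 0 (\<lambda>_. 1) = 0"
  shows "quad A x0 x x0 x \<le> 0"
    and "quad A x0 x x0 x = 0 \<Longrightarrow> i < 3 \<Longrightarrow> (\<Sum>e\<in>{e \<in> nonloops A. c e = i}. x e) = - x0 / 2"
proof -
  define n :: "nat \<Rightarrow> real" where "n i = (\<Sum>e\<in>{e \<in> nonloops A. c e = i}. 1)" for i
  define p where "p i = (\<Sum>e\<in>{e \<in> nonloops A. c e = i}. x e) + x0 / 2" for i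
  note rank_two = quad_rank_two[OF A c]
  have nn: "0 \<le> n i" for i by (simp add: n_def)
  have "quad A 0 (\<lambda>_. 1) 0 (\<lambda>_. 1) = 2 * (n 0 * n 1 + n 1 * n 2 + n 2 * n 0)"
    unfolding rank_two(2) n_def by simp
  then have pos: "0 < n 0 * n 1 + n 1 * n 2 + n 2 * n 0"
    using quad_one_pos[OF A(1)] A(2) by simp
  have "quad A x0 x 0 (\<lambda>_. 1) = p 0 * (n 1 + n 2) + p 1 * (n 2 + n 0) + p 2 * (n 0 + n 1)"
    unfolding rank_two(1) n_def p_def by simp
  then have orth': "p 0 * (n 1 + n 2) + p 1 * (n 2 + n 0) + p 2 * (n 0 + n 1) = 0"
    using orth by simp
  have q: "quad A x0 x x0 x = 2 * (p 0 * p 1 + p 1 * p 2 + p 2 * p 0)"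
    unfolding rank_two(2) p_def by simp
  note hyp = e2_hyperbolic[OF nn nn nn pos orth']
  show "quad A x0 x x0 x \<le> 0" using hyp(1) q by simp
  assume "quad A x0 x x0 x = 0" "i < 3"
  then have "p 0 = 0" "p 1 = 0" "p 2 = 0" "i \<in> {0, 1, 2}" using hyp(2) q by auto
  then have "p i = 0" by auto
  then show "(\<Sum>e\<in>{e \<in> nonloops A. c e = i}. x e) = - x0 / 2" by (simp add: p_def)
qed

text \<open>Induction on the rank of the contraction, with rank two as base and
  \<open>hyperbolic_step\<close> as step.\<close>

lemma hyperbolic_indep:
  assumes "A \<in> \<I>" "card A + 2 \<le> r"
  shows "hyperbolic A"
  using assms
proof (induction "r - card A" arbitrary: A rule: less_induct)
  case less
  show ?case
  proof (cases "card A + 2 = r")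
    case True
    then obtain c where "class_map A c" using ex_class_map less.prems by blast
    then show ?thesis using hyperbolic_rank_two(1) True less.prems by (auto simp: hyperbolic_def)
  next
    case False
    have "hyperbolic (insert g A)" if "g \<in> nonloops A" for g
      using nonloopsD[OF that less.prems(1)] less.prems(2) False by (intro less.hyps) auto
    then show ?thesis
      using hyperbolic_step(1)[OF less.prems(1)] False less.prems(2) by (auto simp: hyperbolic_def)
  qed
qed

text \<open>\<open>A\<close> is built one element at a time, and the equality part of
  \<open>hyperbolic_step\<close> applies at each stage.\<close>

lemma equality_descends:
  assumes "A \<in> \<I>" "card A + 2 \<le> r"
    and "quad {} x0 x 0 (\<lambda>_. 1) = 0" "quad {} x0 x x0 x = 0"
  shows "quad A x0 x 0 (\<lambda>_. 1) = 0 \<and> quad A x0 x x0 x = 0"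
  using finite_indep[OF assms(1)] assms(1,2)
proof (induction A rule: finite_induct)
  case empty
  then show ?case using assms(3,4) by simp
next
  case (insert g A)
  have A: "A \<in> \<I>" using insert.prems(1) by (rule indep_mono) auto
  have c: "card A + 3 \<le> r" using insert by simp
  have g: "g \<in> nonloops A"
    using insert.prems(1) insert.hyps(2) indep_subset_E by (auto simp: nonloops_def)
  have hyp: "hyperbolic (insert h A)" if "h \<in> nonloops A" for h
    using nonloopsD[OF that A] c by (intro hyperbolic_indep) auto
  have IH: "quad A x0 x 0 (\<lambda>_. 1) = 0" "quad A x0 x x0 x = 0"
    using insert.IH[OF A] c by auto
  show ?case using hyperbolic_step(2)[OF A c hyp IH g] .
qed

section \<open>Log-concavity at the top rank and its equality case\<close>

definition count :: "nat \<Rightarrow> real" where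
  "count k = real (card {B \<in> \<I>. card B = k})"

text \<open>Hyperbolicity is applied to the \<open>x0\<close> direction projected off the all-ones
  vector. Up to the factor \<open>2 * (real r * count r)\<close>, the value there is the difference
  of the two sides; equality makes the projection a null vector, which descends to rank two.\<close>

theorem top_log_concavity:
  shows "3 * real r * count (r - 2) * count r \<le> 2 * (real r - 1) * (count (r - 1))\<^sup>2"
    and "3 * real r * count (r - 2) * count r = 2 * (real r - 1) * (count (r - 1))\<^sup>2 \<Longrightarrow>
      \<exists>m>0. \<forall>A c i. A \<in> \<I> \<longrightarrow> card A + 2 = r \<longrightarrow> class_map A c \<longrightarrow> i < 3 \<longrightarrow>
        card {e \<in> nonloops A. c e = i} = m"
proof -
  have above_empty: "real (card (above {} k)) = count k" for k
    by (simp add: above_def count_def)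
  have empty: "{} \<in> \<I>" using base_exists indep_mono by blast
  have pos: "0 < count k" if "k \<le> r" for k
    using card_above_pos[OF empty, of k] that above_empty[of k] by simp
  have r: "2 \<le> real r" using rank_ge_2 by simp
  \<comment> \<open>The projection coefficient, that is, the quotient of \<open>q01\<close> by
    \<open>q11\<close>.\<close>
  define \<kappa> where "\<kappa> = count (r - 1) / (real r * count r)"
  have q11: "quad {} 0 (\<lambda>_. 1) 0 (\<lambda>_. 1) = real r * (real r - 1) * count r"
  proof -
    have "quad {} 0 (\<lambda>_. 1) 0 (\<lambda>_. 1) = (\<Sum>B\<in>above {} r. real r * (real r - 1))"
      unfolding quad_def by (auto simp: above_def algebra_simps intro!: sum.cong)
    then show ?thesis by (simp add: above_empty)
  qed
  have q01: "quad {} 1 (\<lambda>_. 0) 0 (\<lambda>_. 1) = (real r - 1) * count (r - 1)"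
  proof -
    have "quad {} 1 (\<lambda>_. 0) 0 (\<lambda>_. 1) = (\<Sum>B\<in>above {} (r - 1). real r - 1)"
      unfolding quad_def using rank_ge_2 by (auto simp: above_def intro!: sum.cong)
    then show ?thesis by (simp add: above_empty)
  qed
  have q00: "quad {} 1 (\<lambda>_. 0) 1 (\<lambda>_. 0) = 3 / 2 * count (r - 2)"
    by (simp add: quad_def above_empty)
  \<comment> \<open>Written as a sum so that \<open>quad_add\<close> and \<open>grad_add\<close>
    apply with zero as first summand.\<close>
  define x :: "'e \<Rightarrow> real" where "x = (\<lambda>e. 0 + - \<kappa>)"
  have sc: "quad {} x0 y 0 (\<lambda>_. - \<kappa>) = - \<kappa> * quad {} x0 y 0 (\<lambda>_. 1)"
    "quad {} 0 (\<lambda>_. - \<kappa>) 0 z = - \<kappa> * quad {} 0 (\<lambda>_. 1) 0 z" for x0 y z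
    using quad_scale(1)[of "{}" x0 y "- \<kappa>" "\<lambda>_. 1"] quad_scale(2)[of "{}" "- \<kappa>" "\<lambda>_. 1" z]
    by simp_all
  have k: "\<kappa> * (real r * count r) = count (r - 1)"
    using pos[of r] r by (simp add: \<kappa>_def)
  have "quad {} 1 x 0 (\<lambda>_. 1) = quad {} 1 (\<lambda>_. 0) 0 (\<lambda>_. 1) + quad {} 0 (\<lambda>_. - \<kappa>) 0 (\<lambda>_. 1)"
    unfolding x_def quad_eq_grad by (simp only: grad_add distrib_left sum.distrib)
  also have "\<dots> = (real r - 1) * (count (r - 1) - \<kappa> * (real r * count r))"
    unfolding sc q01 q11 by (simp add: algebra_simps)
  finally have orth: "quad {} 1 x 0 (\<lambda>_. 1) = 0" using k by simp
  have "quad {} 1 x 1 x = 3 / 2 * count (r - 2) - 2 * \<kappa> * (real r - 1) * count (r - 1)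
      + \<kappa> * (real r - 1) * (\<kappa> * (real r * count r))"
    unfolding x_def quad_add sc q00 q01 q11 by (simp add: algebra_simps)
  also have "\<dots> = 3 / 2 * count (r - 2) - \<kappa> * (real r - 1) * count (r - 1)"
    unfolding k by simp
  finally have "2 * (real r * count r) * quad {} 1 x 1 x
      = 2 * (real r * count r) * (3 / 2 * count (r - 2) - \<kappa> * (real r - 1) * count (r - 1))"
    by (rule arg_cong)
  also have "\<dots>
      = 3 * real r * count (r - 2) * count r - 2 * (real r - 1) * count (r - 1) * (\<kappa> * (real r * count r))"
    by (simp add: algebra_simps)
  finally have q: "2 * (real r * count r) * quad {} 1 x 1 x
      = 3 * real r * count (r - 2) * count r - 2 * (real r - 1) * (count (r - 1))\<^sup>2"
    unfolding k by (simp add: power2_eq_square)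
  have rc: "0 < 2 * (real r * count r)" using r pos[of r] by simp
  have "hyperbolic {}" using hyperbolic_indep[OF empty] rank_ge_2 by simp
  then have "quad {} 1 x 1 x \<le> 0" using orth by (simp add: hyperbolic_def)
  then have "2 * (real r * count r) * quad {} 1 x 1 x \<le> 0"
    using rc by (simp add: mult_le_0_iff)
  then show "3 * real r * count (r - 2) * count r \<le> 2 * (real r - 1) * (count (r - 1))\<^sup>2"
    using q by simp
  assume "3 * real r * count (r - 2) * count r = 2 * (real r - 1) * (count (r - 1))\<^sup>2"
  then have "2 * (real r * count r) * quad {} 1 x 1 x = 0" using q by simp
  then have eq: "quad {} 1 x 1 x = 0" using rc by (metis less_irrefl mult_eq_0_iff)
  have kpos: "0 < \<kappa>" using pos[of r] pos[of "r - 1"] r by (simp add: \<kappa>_def)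
  \<comment> \<open>A class sum of the constant \<open>- \<kappa>\<close> equals
    \<open>- 1 / 2\<close>, which fixes the class size independently of \<open>A\<close>.\<close>
  have size: "real (card {e \<in> nonloops A. c e = i}) = 1 / (2 * \<kappa>)"
    if "A \<in> \<I>" "card A + 2 = r" "class_map A c" "i < 3" for A c i
  proof -
    have "quad A 1 x 0 (\<lambda>_. 1) = 0 \<and> quad A 1 x 1 x = 0"
      using equality_descends[OF that(1) _ orth eq] that(2) by simp
    then have "(\<Sum>e\<in>{e \<in> nonloops A. c e = i}. x e) = - 1 / 2"
      using hyperbolic_rank_two(2)[OF that(1-3)] that(4) by blast
    then show ?thesis using kpos by (simp add: x_def field_simps)
  qed
  obtain A0 where A0: "A0 \<in> \<I>" "card A0 + 2 = r"
    using extend_indep[OF empty, of "r - 2"] rank_ge_2 by (auto simp: above_def)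
  obtain c0 where c0: "class_map A0 c0" using ex_class_map[OF A0] by blast
  show "\<exists>m>0. \<forall>A c i. A \<in> \<I> \<longrightarrow> card A + 2 = r \<longrightarrow> class_map A c \<longrightarrow> i < 3 \<longrightarrow>
        card {e \<in> nonloops A. c e = i} = m"
  proof (intro exI[of _ "card {e \<in> nonloops A0. c0 e = 0}"] conjI allI impI)
    show "0 < card {e \<in> nonloops A0. c0 e = 0}"
      using size[OF A0 c0, of 0] kpos by (metis of_nat_0_less_iff zero_less_divide_1_iff zero_less_mult_iff zero_less_numeral)
    fix A c and i :: nat
    assume "A \<in> \<I>" "card A + 2 = r" "class_map A c" "i < 3"
    then show "card {e \<in> nonloops A. c e = i} = card {e \<in> nonloops A0. c0 e = 0}"
      using size[of A c i] size[OF A0 c0, of 0] by simp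
  qed
qed

text \<open>Removing \<open>e\<close> and \<open>f\<close> from a base \<open>T\<close> gives a
  contraction with exactly three nonloops: \<open>e\<close>, \<open>f\<close> and one
  \<open>g\<close> outside \<open>T\<close>. All elements outside \<open>T\<close> turn out to
  coincide, and singleton classes make any two of the three nonloops independent.\<close>

lemma one_circuit:
  assumes one: "\<And>A c i. A \<in> \<I> \<Longrightarrow> card A + 2 = r \<Longrightarrow> class_map A c \<Longrightarrow> i < 3 \<Longrightarrow>
      card {e \<in> nonloops A. c e = i} = 1"
    and singletons: "\<And>h. h \<in> E \<Longrightarrow> {h} \<in> \<I>"
  shows "card E = Suc r" and "e \<in> E \<Longrightarrow> E - {e} \<in> \<I>"
proof -
  have pairs: "insert e (insert f A) \<in> \<I>"
    if A: "A \<in> \<I>" "card A + 2 = r" and ef: "e \<in> nonloops A" "f \<in> nonloops A" "e \<noteq> f" for A e f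
  proof -
    obtain c where c: "class_map A c" using ex_class_map[OF A] by blast
    then have "c e < 3" using ef by (simp add: class_map_def)
    then have "card {g \<in> nonloops A. c g = c e} = 1" using one A c by blast
    then obtain x where "{g \<in> nonloops A. c g = c e} = {x}" by (auto simp: card_1_singleton_iff)
    then have "\<forall>g\<in>nonloops A. c g = c e \<longrightarrow> g = x" by blast
    then have "c f \<noteq> c e" using ef by metis
    then show ?thesis using c ef by (auto simp: class_map_def)
  qed
  have three: "card (nonloops A) = 3" if A: "A \<in> \<I>" "card A + 2 = r" for A
  proof -
    obtain c where c: "class_map A c" using ex_class_map[OF A] by blast
    have "real (card (nonloops A)) = 3"
      using sum_class_map[OF c, of "\<lambda>_. 1 :: real"] one[OF A c, of 0] one[OF A c, of 1] one[OF A c, of 2]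
      by simp
    then show ?thesis by simp
  qed
  obtain T where T: "T \<in> \<I>" "card T = r" using base_exists by blast
  have finT: "finite T" using finite_indep T by blast
  have TE: "T \<subseteq> E" using indep_subset_E T by blast
  have minus: "T - {e, f} \<in> \<I>" "card (T - {e, f}) + 2 = r" "e \<in> nonloops (T - {e, f})"
    if "e \<in> T" "f \<in> T" "e \<noteq> f" for e f
  proof -
    show "T - {e, f} \<in> \<I>" using indep_mono[OF T(1)] by blast
    have "card (T - {e, f}) = card T - card {e, f}" using that finT by (intro card_Diff_subset) auto
    then show "card (T - {e, f}) + 2 = r" using T(2) that rank_ge_2 by simp
    have "insert e (T - {e, f}) \<in> \<I>" using that by (intro indep_mono[OF T(1)]) auto
    then show "e \<in> nonloops (T - {e, f})" using that TE by (auto simp: nonloops_def)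
  qed
  \<comment> \<open>As singletons are independent, there is a maximal \<open>X \<subseteq> T\<close>
    with \<open>insert h X\<close> independent; augmentation from \<open>T\<close> shows that it
    misses just one element of \<open>T\<close>.\<close>
  have exchange: "\<exists>e\<in>T. insert h (T - {e}) \<in> \<I>" if h: "h \<in> E - T" for h
  proof -
    define S where "S = {X. X \<subseteq> T \<and> insert h X \<in> \<I>}"
    have "finite S" "{} \<in> S" using finT singletons h by (auto simp: S_def)
    then have "\<exists>X\<in>S. \<forall>Y\<in>S. X \<subseteq> Y \<longrightarrow> X = Y"
      by (intro finite_has_maximal) auto
    then obtain X where "X \<in> S" and X_max: "\<forall>Y\<in>S. X \<subseteq> Y \<longrightarrow> X = Y" by blast
    then have X: "X \<subseteq> T" "insert h X \<in> \<I>" by (auto simp: S_def)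
    have fX: "finite X" using X(1) finT finite_subset by blast
    have hX: "h \<notin> X" using X(1) h by auto
    have "card (insert h X) = r"
    proof (rule ccontr)
      assume "card (insert h X) \<noteq> r"
      then have "card (insert h X) < card T"
        using indep_card_le[OF X(2)] T(2) by simp
      then obtain t where t: "t \<in> T - insert h X" "insert t (insert h X) \<in> \<I>"
        using augment[OF X(2) T(1)] by blast
      then have "insert t X \<in> S" using X(1) by (auto simp: S_def insert_commute)
      then show False using X_max t by blast
    qed
    then have "card (T - X) = 1"
      using fX hX X(1) T(2) by (auto simp: card_Diff_subset)
    then obtain e where "T - X = {e}" by (auto simp: card_1_singleton_iff)
    then have "e \<in> T" "X = T - {e}" using X(1) by auto
    then show ?thesis using X(2) by auto
  qed
  have other: "\<exists>f\<in>T. f \<noteq> e" for e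
  proof (rule ccontr)
    assume "\<not> (\<exists>f\<in>T. f \<noteq> e)"
    then have "T \<subseteq> {e}" by blast
    then have "card T \<le> 1" using card_mono[of "{e}" T] by simp
    then show False using T(2) rank_ge_2 by simp
  qed
  have loopfree: "h \<in> nonloops (T - {e, f})" if "h \<in> E - T" "insert h (T - {e}) \<in> \<I>" for h e f
    using that indep_mono[OF that(2), of "insert h (T - {e, f})"] by (auto simp: nonloops_def)
  have third: "\<exists>g. nonloops (T - {e, f}) = {e, f, g} \<and> g \<in> E - T"
    if "e \<in> T" "f \<in> T" "e \<noteq> f" for e f
  proof -
    have ef: "{e, f} \<subseteq> nonloops (T - {e, f})"
      using minus(3)[OF that] minus(3)[of f e] that by (auto simp: insert_commute)
    then have "card (nonloops (T - {e, f}) - {e, f}) = 1"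
      using three[OF minus(1,2)[OF that]] that by (simp add: card_Diff_subset)
    then obtain g where g: "nonloops (T - {e, f}) - {e, f} = {g}" by (auto simp: card_1_singleton_iff)
    then have "g \<in> nonloops (T - {e, f})" "g \<notin> {e, f}" by auto
    then have "g \<in> E - T" by (auto simp: nonloops_def)
    then show ?thesis using g ef by blast
  qed
  \<comment> \<open>\<open>f\<close> is chosen so that \<open>{e, f}\<close> contains both exchange
    partners. Then \<open>h\<close> and \<open>h'\<close> are nonloops of the same contraction,
    which has only one outside \<open>T\<close>.\<close>
  have unique: "h = h'" if h: "h \<in> E - T" "h' \<in> E - T" for h h'
  proof -
    obtain e e' where e: "e \<in> T" "insert h (T - {e}) \<in> \<I>" and e': "e' \<in> T" "insert h' (T - {e'}) \<in> \<I>"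
      using exchange h by blast
    obtain f where f: "f \<in> T" "f \<noteq> e" "e' = e \<or> e' = f"
      using other[of e] e' by blast
    have "h' \<in> nonloops (T - {e, f})"
      using loopfree[OF h(2) e'(2), of e] loopfree[OF h(2) e'(2), of f] f by (auto simp: insert_commute)
    moreover have "h \<in> nonloops (T - {e, f})" using loopfree[OF h(1) e(2)] .
    ultimately show ?thesis using third[of e f] e f h by auto
  qed
  obtain e0 where e0: "e0 \<in> T" using other by blast
  obtain f0 where f0: "f0 \<in> T" "f0 \<noteq> e0" using other by blast
  obtain g where g: "g \<in> E - T" using third[OF e0 f0(1)] f0 by blast
  have E: "E = insert g T" using g unique TE by blast
  then show "card E = Suc r" using g finT T(2) by simp
  assume e: "e \<in> E"
  show "E - {e} \<in> \<I>"
  proof (cases "e = g")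
    case True
    then show ?thesis using E g T by simp
  next
    case False
    then have eT: "e \<in> T" using e E by simp
    obtain f where f: "f \<in> T" "f \<noteq> e" using other by blast
    have "g \<in> nonloops (T - {e, f})" "f \<in> nonloops (T - {e, f})"
      using third[OF eT f(1)] f unique g by blast+
    then have "insert g (insert f (T - {e, f})) \<in> \<I>"
      using pairs[OF minus(1,2)[OF eT f(1)]] f g by blast
    moreover have "insert g (insert f (T - {e, f})) = E - {e}" using E f eT g by auto
    ultimately show ?thesis by simp
  qed
qed

end

section \<open>Forests of a simple graph\<close>

definition edge_rel :: "'a set set \<Rightarrow> ('a \<times> 'a) set" where
  "edge_rel F = {(x, y). {x, y} \<in> F}"

lemma sym_edge_rel: "sym (edge_rel F)"
  by (auto simp: sym_def edge_rel_def insert_commute)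

lemma edge_rel_rtrancl_sym: "(x, y) \<in> (edge_rel F)\<^sup>* \<Longrightarrow> (y, x) \<in> (edge_rel F)\<^sup>*"
  using sym_rtrancl[OF sym_edge_rel] by (meson symD)

lemma edge_rel_mono: "F \<subseteq> F' \<Longrightarrow> (edge_rel F)\<^sup>* \<subseteq> (edge_rel F')\<^sup>*"
  by (intro rtrancl_mono) (auto simp: edge_rel_def)

lemma edge_rel_insert: "edge_rel (insert {u, v} F) = insert (u, v) (insert (v, u) (edge_rel F))"
  by (auto simp: edge_rel_def doubleton_eq_iff)

text \<open>The new edge need be used at most once, in one of its two directions.\<close>

lemma rtrancl_edge_rel_insert:
  "(x, y) \<in> (edge_rel (insert {u, v} F))\<^sup>* \<longleftrightarrow> (x, y) \<in> (edge_rel F)\<^sup>*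
     \<or> (x, u) \<in> (edge_rel F)\<^sup>* \<and> (v, y) \<in> (edge_rel F)\<^sup>*
     \<or> (x, v) \<in> (edge_rel F)\<^sup>* \<and> (u, y) \<in> (edge_rel F)\<^sup>*"
  unfolding edge_rel_insert rtrancl_insert
  by (auto intro: rtrancl_trans)

lemma isolated_rtrancl:
  assumes "(x, y) \<in> (edge_rel F)\<^sup>*" "\<forall>e\<in>F. y \<notin> e"
  shows "x = y"
  using assms by (induction rule: rtrancl_induct) (auto simp: edge_rel_def)

lemma edge_endpoints:
  assumes "simple_graph V E" "e \<in> E"
  obtains u v where "e = {u, v}" "u \<noteq> v" "u \<in> V" "v \<in> V"
proof -
  have e: "e \<subseteq> V" "card e = 2" using assms by (auto simp: simple_graph_def)
  then obtain u v where "e = {u, v}" "u \<noteq> v" by (meson card_2_iff)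
  then show ?thesis using e(1) that by simp
qed

lemma simple_graph_subset: "simple_graph V E \<Longrightarrow> F \<subseteq> E \<Longrightarrow> simple_graph V F"
  by (auto simp: simple_graph_def)

lemma simple_graph_finite: "simple_graph V E \<Longrightarrow> finite E"
  unfolding simple_graph_def by (meson PowI finite_Pow_iff finite_subset subsetI)

section \<open>Cycles, paths and acyclicity\<close>

lemma acyclic_mono: "acyclic_edges F \<Longrightarrow> F' \<subseteq> F \<Longrightarrow> acyclic_edges F'"
  unfolding acyclic_edges_def by blast

text \<open>Distinct positions succeed each other both ways only in a cycle of length two.\<close>

lemma mod_Suc_neq:
  fixes i n :: nat
  assumes "i < n" "j < n" "i \<noteq> j" "3 \<le> n" "j = Suc i mod n"
  shows "i \<noteq> Suc j mod n"
proof (cases "Suc i = n")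
  case True
  then show ?thesis using assms by simp
next
  case False
  then have "j = Suc i" using assms by simp
  then show ?thesis using assms(1,2,4) by (cases "Suc j = n") auto
qed

text \<open>Since \<open>vs\<close> is distinct, equal edges at different positions would make these
  positions cyclic successors of each other.\<close>

lemma cycle_edge_inj:
  assumes "cycle_list vs" "i < length vs" "j < length vs"
    and "{vs ! i, vs ! (Suc i mod length vs)} = {vs ! j, vs ! (Suc j mod length vs)}"
  shows "i = j"
proof (rule ccontr)
  assume "i \<noteq> j"
  have d: "distinct vs" "3 \<le> length vs" using assms by (auto simp: cycle_list_def)
  have l: "Suc i mod length vs < length vs" "Suc j mod length vs < length vs"
    using assms by (auto intro!: mod_less_divisor)
  have "i = Suc j mod length vs" "j = Suc i mod length vs"
    using assms \<open>i \<noteq> j\<close> d l by (auto simp: doubleton_eq_iff nth_eq_iff_index_eq)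
  then show False using mod_Suc_neq[OF assms(2,3) \<open>i \<noteq> j\<close> d(2)] by blast
qed

lemma card_cycle_edges:
  assumes "cycle_list vs"
  shows "card (cycle_edges vs) = length vs"
proof -
  have "cycle_edges vs = (\<lambda>i. {vs ! i, vs ! (Suc i mod length vs)}) ` {..<length vs}"
    by (auto simp: cycle_edges_def)
  moreover have "inj_on (\<lambda>i. {vs ! i, vs ! (Suc i mod length vs)}) {..<length vs}"
    using cycle_edge_inj[OF assms] by (auto simp: inj_on_def)
  ultimately show ?thesis by (simp add: card_image)
qed

lemma acyclic_edges_empty: "acyclic_edges {}"
proof -
  have "cycle_edges vs \<noteq> {}" if "cycle_list vs" for vs :: "'a list"
    using card_cycle_edges[OF that] that by (auto simp: cycle_list_def)
  then show ?thesis by (auto simp: acyclic_edges_def)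
qed

text \<open>Walk around the cycle the other way, from the far end of the removed edge.\<close>

lemma cycle_minus_edge_joined:
  assumes vs: "cycle_list vs" and i: "i < length vs"
  defines "e \<equiv> {vs ! i, vs ! (Suc i mod length vs)}"
  shows "(vs ! (Suc i mod length vs), vs ! i) \<in> (edge_rel (cycle_edges vs - {e}))\<^sup>*"
proof -
  let ?n = "length vs" and ?R = "edge_rel (cycle_edges vs - {e})"
  have n: "3 \<le> ?n" using vs by (simp add: cycle_list_def)
  have "(vs ! (Suc i mod ?n), vs ! ((Suc i + k) mod ?n)) \<in> ?R\<^sup>*" if "k < ?n" for k
    using that
  proof (induction k)
    case (Suc k)
    let ?j = "(Suc i + k) mod ?n"
    have j: "?j < ?n" using n by (intro mod_less_divisor) auto
    \<comment> \<open>The walk would use the removed edge only if \<open>length vs\<close> divided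
      \<open>Suc k\<close>, which is too small.\<close>
    have "?j \<noteq> i"
    proof
      assume "?j = i"
      then have "(Suc i + k) mod ?n = i mod ?n" using i by simp
      then have "?n dvd Suc k" using mod_eq_dvd_iff_nat[of i "Suc i + k" ?n] by simp
      then show False using Suc.prems by (auto dest: dvd_imp_le)
    qed
    then have "{vs ! ?j, vs ! (Suc ?j mod ?n)} \<noteq> e"
      using cycle_edge_inj[OF vs j i] unfolding e_def by blast
    then have "(vs ! ?j, vs ! (Suc ?j mod ?n)) \<in> ?R"
      using j by (auto simp: edge_rel_def cycle_edges_def)
    moreover have "Suc ?j mod ?n = (Suc i + Suc k) mod ?n" by (simp add: mod_Suc_eq)
    ultimately have "(vs ! ?j, vs ! ((Suc i + Suc k) mod ?n)) \<in> ?R" by simp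
    then show ?case using Suc by (meson Suc_lessD rtrancl.rtrancl_into_rtrancl)
  qed simp
  from this[of "?n - 1"] n
  have "(vs ! (Suc i mod ?n), vs ! ((Suc i + (?n - 1)) mod ?n)) \<in> ?R\<^sup>*" by simp
  moreover have "Suc i + (?n - 1) = i + ?n" using n by simp
  ultimately show ?thesis using i by simp
qed

text \<open>Loop erasure: when the next vertex already lies on the path, the path is cut back to
  it.\<close>

lemma rtrancl_distinct_path:
  assumes "(u, v) \<in> R\<^sup>*"
  shows "\<exists>p. p \<noteq> [] \<and> distinct p \<and> p ! 0 = u \<and> p ! (length p - 1) = v
    \<and> (\<forall>i. Suc i < length p \<longrightarrow> (p ! i, p ! Suc i) \<in> R)"
  using assms
proof (induction rule: rtrancl_induct)
  case base
  show ?case by (rule exI[of _ "[u]"]) simp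
next
  case (step y z)
  then obtain p where p: "p \<noteq> []" "distinct p" "p ! 0 = u" "p ! (length p - 1) = y"
    "\<And>i. Suc i < length p \<Longrightarrow> (p ! i, p ! Suc i) \<in> R" by blast
  show ?case
  proof (cases "z \<in> set p")
    case True
    then obtain i where i: "i < length p" "p ! i = z" by (auto simp: in_set_conv_nth)
    show ?thesis
      by (rule exI[of _ "take (Suc i) p"]) (use p i in auto)
  next
    case False
    have "((p @ [z]) ! i, (p @ [z]) ! Suc i) \<in> R" if "Suc i < length (p @ [z])" for i
    proof (cases "Suc i = length p")
      case True
      then have "i = length p - 1" by simp
      then show ?thesis using True p step(2) by (simp add: nth_append)
    next
      case False
      then show ?thesis using that p(5)[of i] by (simp add: nth_append)
    qed
    then show ?thesis
      using p False by (intro exI[of _ "p @ [z]"]) (auto simp: nth_append)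
  qed
qed

text \<open>The new edge closes a simple path between its ends to a cycle; conversely, a cycle
  through the new edge joins these ends without it.\<close>

lemma acyclic_insert_iff:
  assumes F: "acyclic_edges F" and e: "{u, v} \<notin> F" "u \<noteq> v"
  shows "acyclic_edges (insert {u, v} F) \<longleftrightarrow> (u, v) \<notin> (edge_rel F)\<^sup>*"
proof
  assume ac: "acyclic_edges (insert {u, v} F)"
  show "(u, v) \<notin> (edge_rel F)\<^sup>*"
  proof
    assume "(u, v) \<in> (edge_rel F)\<^sup>*"
    then obtain p where p: "p \<noteq> []" "distinct p" "p ! 0 = u" "p ! (length p - 1) = v"
      "\<And>i. Suc i < length p \<Longrightarrow> (p ! i, p ! Suc i) \<in> edge_rel F"
      using rtrancl_distinct_path[of u v "edge_rel F"] by blast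
    \<comment> \<open>Length one would mean \<open>u = v\<close>, and length two that
      \<open>{u, v}\<close> lies in \<open>F\<close>.\<close>
    have "length p \<noteq> 1" using p e by auto
    moreover have "length p \<noteq> 2" using p(3,4) p(5)[of 0] e by (auto simp: edge_rel_def)
    ultimately have len: "3 \<le> length p" using p(1) by (cases p) (auto simp: neq_Nil_conv)
    have "cycle_edges p \<subseteq> insert {u, v} F"
    proof
      fix f assume "f \<in> cycle_edges p"
      then obtain i where i: "i < length p" "f = {p ! i, p ! (Suc i mod length p)}"
        by (auto simp: cycle_edges_def)
      show "f \<in> insert {u, v} F"
      proof (cases "Suc i = length p")
        case True
        then have "i = length p - 1" by simp
        then have "f = {v, u}" using i True p by simp
        then show ?thesis by auto
      next
        case False
        then have "Suc i < length p" using i by simp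
        then show ?thesis using i p(5)[of i] by (simp add: edge_rel_def)
      qed
    qed
    then show False using ac len p(2) by (auto simp: acyclic_edges_def cycle_list_def)
  qed
next
  assume nj: "(u, v) \<notin> (edge_rel F)\<^sup>*"
  show "acyclic_edges (insert {u, v} F)"
    unfolding acyclic_edges_def
  proof
    assume "\<exists>vs. cycle_list vs \<and> cycle_edges vs \<subseteq> insert {u, v} F"
    then obtain vs where vs: "cycle_list vs" "cycle_edges vs \<subseteq> insert {u, v} F" by blast
    have "{u, v} \<in> cycle_edges vs" using vs F unfolding acyclic_edges_def by blast
    then obtain i where i: "i < length vs" "{u, v} = {vs ! i, vs ! (Suc i mod length vs)}"
      by (auto simp: cycle_edges_def)
    have "(vs ! (Suc i mod length vs), vs ! i) \<in> (edge_rel F)\<^sup>*"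
      using cycle_minus_edge_joined[OF vs(1) i(1)] edge_rel_mono[of "cycle_edges vs - {{u, v}}" F] vs(2)
      unfolding i(2)[symmetric] by blast
    then show False using i(2) nj by (auto simp: doubleton_eq_iff dest: edge_rel_rtrancl_sym)
  qed
qed

section \<open>Components and the rank of a forest\<close>

definition component :: "'a set \<Rightarrow> 'a set set \<Rightarrow> 'a \<Rightarrow> 'a set" where
  "component V F u = {v \<in> V. (u, v) \<in> (edge_rel F)\<^sup>*}"

definition components :: "'a set \<Rightarrow> 'a set set \<Rightarrow> 'a set set" where
  "components V F = component V F ` V"

lemma component_eq_iff: "u \<in> V \<Longrightarrow> v \<in> V \<Longrightarrow> component V F u = component V F v \<longleftrightarrow> (u, v) \<in> (edge_rel F)\<^sup>*"
  unfolding component_def by (auto intro: rtrancl_trans edge_rel_rtrancl_sym)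

text \<open>The components of \<open>u\<close> and \<open>v\<close> merge, and all others stay as
  they are.\<close>

lemma card_components_insert:
  assumes V: "finite V" "u \<in> V" "v \<in> V" and nj: "(u, v) \<notin> (edge_rel F)\<^sup>*"
  shows "Suc (card (components V (insert {u, v} F))) = card (components V F)"
proof -
  let ?c = "component V F" and ?C = "components V F"
  let ?m = "?c u \<union> ?c v"
  have new: "component V (insert {u, v} F) x = (if x \<in> ?m then ?m else ?c x)" if "x \<in> V" for x
    using that unfolding component_def rtrancl_edge_rel_insert
    by (auto intro: rtrancl_trans edge_rel_rtrancl_sym)
  have neq: "?c u \<noteq> ?c v" using nj component_eq_iff V by metis
  have in_m: "x \<in> ?m \<longleftrightarrow> ?c x = ?c u \<or> ?c x = ?c v" if "x \<in> V" for x
    using that V component_eq_iff[of _ V _ F] by (auto simp: component_def dest: edge_rel_rtrancl_sym)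
  have uv: "?c u \<in> ?C" "?c v \<in> ?C" using V by (auto simp: components_def)
  have "components V (insert {u, v} F) = insert ?m (?C - {?c u, ?c v})"
  proof -
    have "components V (insert {u, v} F) = (\<lambda>x. if x \<in> ?m then ?m else ?c x) ` V"
      unfolding components_def using new by simp
    also have "\<dots> = (\<lambda>x. if ?c x = ?c u \<or> ?c x = ?c v then ?m else ?c x) ` V"
      using in_m by (intro image_cong) auto
    also have "\<dots> = insert ?m (?C - {?c u, ?c v})"
      using V(2) by (auto simp: components_def image_iff)
    finally show ?thesis .
  qed
  moreover have "?m \<notin> ?C"
  proof
    assume "?m \<in> ?C"
    then obtain x where x: "x \<in> V" "?m = ?c x" by (auto simp: components_def)
    have "u \<in> ?c x" "v \<in> ?c x" using V x(2)[symmetric] by (auto simp: component_def)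
    then have "(u, v) \<in> (edge_rel F)\<^sup>*"
      by (auto simp: component_def intro: rtrancl_trans edge_rel_rtrancl_sym)
    then show False using nj by blast
  qed
  moreover have "finite ?C" using V by (simp add: components_def)
  moreover have "card (?C - {?c u, ?c v}) = card ?C - 2"
    using neq uv by (subst card_Diff_subset) auto
  moreover have "2 \<le> card ?C"
    using card_mono[OF \<open>finite ?C\<close>, of "{?c u, ?c v}"] uv neq by simp
  ultimately show ?thesis by simp
qed

lemma card_components_acyclic:
  assumes "simple_graph V F" "acyclic_edges F"
  shows "card (components V F) + card F = card V"
  using simple_graph_finite[OF assms(1)] assms
proof (induction F rule: finite_induct)
  case empty
  have "component V {} u = {u}" if "u \<in> V" for u
    using that isolated_rtrancl[of u _ "{}"] by (auto simp: component_def)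
  then have "components V {} = (\<lambda>u. {u}) ` V" by (simp add: components_def)
  then show ?case by (simp add: card_image)
next
  case (insert e F)
  obtain u v where e: "e = {u, v}" "u \<noteq> v" "u \<in> V" "v \<in> V"
    using edge_endpoints insert.prems(1) by (metis insertI1)
  have F: "simple_graph V F" "acyclic_edges F"
    using insert.prems simple_graph_subset acyclic_mono by blast+
  have "(u, v) \<notin> (edge_rel F)\<^sup>*"
    using acyclic_insert_iff[OF F(2)] insert e by blast
  then have "Suc (card (components V (insert e F))) = card (components V F)"
    using card_components_insert[of V u v F] e insert.prems(1) by (simp add: simple_graph_def)
  then show ?case using insert.IH[OF F] insert.hyps by simp
qed

text \<open>Sending each component of \<open>Y\<close> to the \<open>X\<close>-component of a
  representative covers all components of \<open>X\<close>.\<close>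

lemma card_components_antimono:
  assumes "finite V" "(edge_rel Y)\<^sup>* \<subseteq> (edge_rel X)\<^sup>*"
  shows "card (components V X) \<le> card (components V Y)"
proof -
  have "components V X \<subseteq> (\<lambda>C. component V X (SOME u. u \<in> C)) ` components V Y"
  proof
    fix C assume "C \<in> components V X"
    then obtain u where u: "u \<in> V" "C = component V X u" by (auto simp: components_def)
    define w where "w = (SOME w. w \<in> component V Y u)"
    have "u \<in> component V Y u" using u by (simp add: component_def)
    then have "w \<in> component V Y u" unfolding w_def by (rule someI)
    then have "w \<in> V" "(u, w) \<in> (edge_rel X)\<^sup>*" using assms(2) by (auto simp: component_def)
    then have "C = component V X w" using u component_eq_iff by metis
    then show "C \<in> (\<lambda>C. component V X (SOME u. u \<in> C)) ` components V Y"
      using u by (auto simp: components_def w_def)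
  qed
  moreover have "finite (components V Y)" using assms by (simp add: components_def)
  ultimately show ?thesis by (meson card_image_le card_mono finite_imageI le_trans)
qed

text \<open>Otherwise every edge of \<open>Y\<close> lies within a component of \<open>X\<close>, so
  \<open>X\<close> has at most as many components as \<open>Y\<close>, against the count in
  \<open>card_components_acyclic\<close>.\<close>

lemma acyclic_augment:
  assumes "simple_graph V X" "simple_graph V Y" "acyclic_edges X" "acyclic_edges Y" "card X < card Y"
  shows "\<exists>e\<in>Y - X. acyclic_edges (insert e X)"
proof (rule ccontr)
  assume neg: "\<not> ?thesis"
  have "edge_rel Y \<subseteq> (edge_rel X)\<^sup>*"
  proof safe
    fix u v assume "(u, v) \<in> edge_rel Y"
    then have Y: "{u, v} \<in> Y" by (simp add: edge_rel_def)
    then have "u \<noteq> v" using assms(2) by (auto simp: simple_graph_def)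
    show "(u, v) \<in> (edge_rel X)\<^sup>*"
    proof (cases "{u, v} \<in> X")
      case True
      then show ?thesis by (auto simp: edge_rel_def)
    next
      case False
      then show ?thesis using neg Y acyclic_insert_iff[OF assms(3) False \<open>u \<noteq> v\<close>] by blast
    qed
  qed
  then have "(edge_rel Y)\<^sup>* \<subseteq> (edge_rel X)\<^sup>*" by (rule rtrancl_subset_rtrancl)
  then have "card (components V X) \<le> card (components V Y)"
    using assms(1) by (intro card_components_antimono) (auto simp: simple_graph_def)
  then show False
    using card_components_acyclic[OF assms(1,3)] card_components_acyclic[OF assms(2,4)] assms(5) by simp
qed

text \<open>Kruskal's greedy choice: an edge is kept exactly if its ends are not yet joined.\<close>

lemma spanning_forest_exists:
  assumes "simple_graph V F"
  shows "\<exists>B\<subseteq>F. acyclic_edges B \<and> (edge_rel B)\<^sup>* = (edge_rel F)\<^sup>*"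
  using simple_graph_finite[OF assms] assms
proof (induction F rule: finite_induct)
  case empty
  show ?case by (simp add: acyclic_edges_empty)
next
  case (insert e F)
  obtain u v where e: "e = {u, v}" "u \<noteq> v"
    using edge_endpoints insert.prems(1) by (metis insertI1)
  obtain B where B: "B \<subseteq> F" "acyclic_edges B" "(edge_rel B)\<^sup>* = (edge_rel F)\<^sup>*"
    using insert.IH insert.prems simple_graph_subset by blast
  have ins: "(edge_rel (insert e B))\<^sup>* = (edge_rel (insert e F))\<^sup>*"
    by (auto simp: e(1) rtrancl_edge_rel_insert B(3))
  show ?case
  proof (cases "(u, v) \<in> (edge_rel B)\<^sup>*")
    case True
    have "(edge_rel (insert e B))\<^sup>* = (edge_rel B)\<^sup>*"
    proof -
      have "(a, b) \<in> (edge_rel B)\<^sup>*"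
        if "(a, u) \<in> (edge_rel B)\<^sup>* \<and> (v, b) \<in> (edge_rel B)\<^sup>*
          \<or> (a, v) \<in> (edge_rel B)\<^sup>* \<and> (u, b) \<in> (edge_rel B)\<^sup>*" for a b
        using that True edge_rel_rtrancl_sym[OF True] by (meson rtrancl_trans)
      then have "(a, b) \<in> (edge_rel (insert e B))\<^sup>* \<longleftrightarrow> (a, b) \<in> (edge_rel B)\<^sup>*" for a b
        unfolding e(1) rtrancl_edge_rel_insert by blast
      then show ?thesis by (simp add: set_eq_iff split_paired_all)
    qed
    then show ?thesis
      using B ins by (intro exI[of _ B] conjI) (simp_all add: subset_insertI2)
  next
    case False
    have "{u, v} \<notin> B" using B(1) insert.hyps(2) e by blast
    then have "acyclic_edges (insert e B)"
      using acyclic_insert_iff[OF B(2) _ e(2)] False e(1) by simp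
    then show ?thesis using B(1) ins by (intro exI[of _ "insert e B"] conjI) (simp_all add: subset_insertI2)
  qed
qed

lemma card_components_connected:
  assumes "V \<noteq> {}" "\<forall>u\<in>V. \<forall>v\<in>V. (u, v) \<in> (edge_rel F)\<^sup>*"
  shows "card (components V F) = 1"
proof -
  obtain u where u: "u \<in> V" using assms by blast
  have "component V F v = V" if "v \<in> V" for v using assms that by (auto simp: component_def)
  then have "components V F = {V}" using u by (auto simp: components_def)
  then show ?thesis by simp
qed

text \<open>Contracting \<open>A\<close> leaves a multigraph on three vertices. \<open>k e\<close>
  is the pair of components joined by \<open>e\<close>, and \<open>c e\<close> numbers this pair by
  the component it misses; edges with the same pair are parallel.\<close>

lemma three_component_classes:
  assumes G: "simple_graph V E" and A: "A \<subseteq> E" "acyclic_edges A" "card (components V A) = 3"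
  shows "\<exists>c :: 'a set \<Rightarrow> nat.
    (\<forall>e\<in>E - A. acyclic_edges (insert e A) \<longrightarrow> c e < 3) \<and>
    (\<forall>e\<in>E - A. \<forall>f\<in>E - A. acyclic_edges (insert e A) \<longrightarrow> acyclic_edges (insert f A) \<longrightarrow> e \<noteq> f \<longrightarrow>
      (acyclic_edges (insert e (insert f A)) \<longleftrightarrow> c e \<noteq> c f))"
proof -
  obtain C0 C1 C2 where C: "components V A = {C0, C1, C2}" "C0 \<noteq> C1" "C0 \<noteq> C2" "C1 \<noteq> C2"
    using A(3) by (auto simp: card_3_iff)
  define k where "k e = component V A ` e" for e
  define c :: "'a set \<Rightarrow> nat" where "c e = (if C0 \<notin> k e then 0 else if C1 \<notin> k e then 1 else 2)" for e
  have k: "k e \<in> {{C1, C2}, {C0, C2}, {C0, C1}}"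
    if ef: "e \<in> E - A" "acyclic_edges (insert e A)" for e
  proof -
    obtain u v where e: "e = {u, v}" "u \<noteq> v" "u \<in> V" "v \<in> V"
      by (rule edge_endpoints[OF G, of e]) (use ef in auto)
    have neq: "component V A u \<noteq> component V A v"
      using acyclic_insert_iff[OF A(2), of u v] ef e component_eq_iff[of u V v A] by auto
    have mem: "component V A u \<in> {C0, C1, C2}" "component V A v \<in> {C0, C1, C2}"
      using e unfolding C(1)[symmetric] components_def by auto
    have pair: "{X, Y} \<in> {{C1, C2}, {C0, C2}, {C0, C1}}"
      if "X \<noteq> Y" "X \<in> {C0, C1, C2}" "Y \<in> {C0, C1, C2}" for X Y
      using that by (elim insertE emptyE) (simp_all add: insert_commute)
    show ?thesis
      unfolding k_def e(1) image_insert image_empty by (rule pair[OF neq mem])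
  qed
  have eq: "c e = c f \<longleftrightarrow> k e = k f"
    if "e \<in> E - A" "acyclic_edges (insert e A)" "f \<in> E - A" "acyclic_edges (insert f A)" for e f
    using k[OF that(1,2)] k[OF that(3,4)]
    by (elim insertE emptyE) (simp_all add: c_def doubleton_eq_iff C(2-4) C(2-4)[symmetric])
  have ind: "acyclic_edges (insert e (insert f A)) \<longleftrightarrow> k e \<noteq> k f"
    if ef: "e \<in> E - A" "acyclic_edges (insert e A)" "f \<in> E - A" "acyclic_edges (insert f A)" "e \<noteq> f" for e f
  proof -
    obtain u v where e: "e = {u, v}" "u \<noteq> v" "u \<in> V" "v \<in> V"
      by (rule edge_endpoints[OF G, of e]) (use ef in auto)
    obtain a b where f: "f = {a, b}" "a \<noteq> b" "a \<in> V" "b \<in> V"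
      by (rule edge_endpoints[OF G, of f]) (use ef in auto)
    have nj: "(u, v) \<notin> (edge_rel A)\<^sup>*"
      using acyclic_insert_iff[OF A(2), of u v] ef e by auto
    have "acyclic_edges (insert e (insert f A)) \<longleftrightarrow> (u, v) \<notin> (edge_rel (insert f A))\<^sup>*"
      unfolding e(1) using ef e by (intro acyclic_insert_iff) auto
    \<comment> \<open>The ends of \<open>e\<close> lie in different components of \<open>A\<close>,
      so they can be joined only through \<open>f\<close>, whose ends must then lie in the same two
      components.\<close>
    also have "\<dots> \<longleftrightarrow> \<not> (component V A u = component V A a \<and> component V A v = component V A b
        \<or> component V A u = component V A b \<and> component V A v = component V A a)"
    proof -
      have "(b, v) \<in> (edge_rel A)\<^sup>* \<longleftrightarrow> (v, b) \<in> (edge_rel A)\<^sup>*"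
        "(a, v) \<in> (edge_rel A)\<^sup>* \<longleftrightarrow> (v, a) \<in> (edge_rel A)\<^sup>*"
        by (blast intro: edge_rel_rtrancl_sym)+
      then show ?thesis
        unfolding f(1) rtrancl_edge_rel_insert using nj e(3,4) f(3,4) by (simp add: component_eq_iff)
    qed
    also have "\<dots> \<longleftrightarrow> k e \<noteq> k f"
      unfolding k_def e(1) f(1) image_insert image_empty doubleton_eq_iff by blast
    finally show ?thesis .
  qed
  show ?thesis
  proof (intro exI[of _ c] conjI ballI impI)
    show "c e < 3" for e by (simp add: c_def)
    show "acyclic_edges (insert e (insert f A)) \<longleftrightarrow> c e \<noteq> c f"
      if "e \<in> E - A" "f \<in> E - A" "acyclic_edges (insert e A)" "acyclic_edges (insert f A)" "e \<noteq> f"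
      for e f
      using ind[of e f] eq[of e f] that by simp
  qed
qed

section \<open>The graphic matroid and its contractions\<close>

definition forests :: "'a set set \<Rightarrow> 'a set set set" where
  "forests E = {F. F \<subseteq> E \<and> acyclic_edges F}"

lemma in_forests_iff [simp]: "F \<in> forests E \<longleftrightarrow> F \<subseteq> E \<and> acyclic_edges F"
  by (simp add: forests_def)

lemma connected_graph_edge_rel:
  "connected_graph V E \<longleftrightarrow> V \<noteq> {} \<and> (\<forall>u\<in>V. \<forall>v\<in>V. (u, v) \<in> (edge_rel E)\<^sup>*)"
  by (simp add: connected_graph_def edge_rel_def)

lemma spanning_tree_exists:
  assumes "simple_graph V E" "connected_graph V E"
  shows "\<exists>B\<in>forests E. card B + 1 = card V"
proof -
  obtain B where B: "B \<subseteq> E" "acyclic_edges B" "(edge_rel B)\<^sup>* = (edge_rel E)\<^sup>*"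
    using spanning_forest_exists[OF assms(1)] by blast
  have "card (components V B) = 1"
    using assms(2) B(3) by (intro card_components_connected) (simp_all add: connected_graph_edge_rel)
  then show ?thesis
    using card_components_acyclic[OF simple_graph_subset[OF assms(1) B(1)] B(2)] B(1,2)
    by (intro bexI[of _ B]) auto
qed

lemma forests_three_class_matroid:
  assumes G: "simple_graph V E" "connected_graph V E" and N: "3 \<le> card V"
  shows "three_class_matroid E (forests E) (card V - 1)"
proof
  show "finite E" using simple_graph_finite G(1) .
  show "B \<subseteq> E" if "B \<in> forests E" for B using that by simp
  show "A \<in> forests E" if "B \<in> forests E" "A \<subseteq> B" for A B
    using that acyclic_mono[of B A] by auto
  show "\<exists>e\<in>B - A. insert e A \<in> forests E"
    if "A \<in> forests E" "B \<in> forests E" "card A < card B" for A B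
  proof -
    have "\<exists>e\<in>B - A. acyclic_edges (insert e A)"
      using that simple_graph_subset[OF G(1)] by (intro acyclic_augment[of V]) auto
    then show ?thesis using that by auto
  qed
  show "\<exists>B\<in>forests E. card B = card V - 1"
  proof -
    obtain B where "B \<in> forests E" "card B + 1 = card V" using spanning_tree_exists[OF G] by blast
    then show ?thesis by (intro bexI[of _ B]) simp_all
  qed
  have sum: "card (components V B) + card B = card V" if "B \<in> forests E" for B
    using that card_components_acyclic[OF simple_graph_subset[OF G(1)]] by simp
  show "card B \<le> card V - 1" if "B \<in> forests E" for B
  proof -
    have "card (components V B) \<noteq> 0" using G by (simp add: components_def simple_graph_def connected_graph_def)
    then show ?thesis using sum[OF that] by linarith
  qed
  show "2 \<le> card V - 1" using N by simp
  show "\<exists>c :: 'a set \<Rightarrow> nat. (\<forall>e\<in>E - A. insert e A \<in> forests E \<longrightarrow> c e < 3) \<and>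
      (\<forall>e\<in>E - A. \<forall>f\<in>E - A. insert e A \<in> forests E \<longrightarrow> insert f A \<in> forests E \<longrightarrow> e \<noteq> f \<longrightarrow>
        (insert e (insert f A) \<in> forests E \<longleftrightarrow> c e \<noteq> c f))"
    if "A \<in> forests E" "card A + 2 = card V - 1" for A
  proof -
    have A: "A \<subseteq> E" "acyclic_edges A" using that(1) by simp_all
    have three: "card (components V A) = 3" using sum[OF that(1)] that(2) N by linarith
    obtain c :: "'a set \<Rightarrow> nat" where
      "(\<forall>e\<in>E - A. acyclic_edges (insert e A) \<longrightarrow> c e < 3) \<and>
      (\<forall>e\<in>E - A. \<forall>f\<in>E - A. acyclic_edges (insert e A) \<longrightarrow> acyclic_edges (insert f A) \<longrightarrow> e \<noteq> f \<longrightarrow>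
        (acyclic_edges (insert e (insert f A)) \<longleftrightarrow> c e \<noteq> c f))"
      using three_component_classes[OF G(1) A three] by (rule exE) (rule that)
    then show ?thesis using A(1) by (intro exI[of _ c]) simp
  qed
qed

text \<open>The tree grows one edge at a time; connectedness of the graph supplies an edge leaving
  \<open>S\<close>.\<close>

lemma tree_on_subset:
  assumes G: "simple_graph V E" "connected_graph V E" and "k < card V"
  shows "\<exists>S A. S \<subseteq> V \<and> card S = Suc k \<and> A \<in> forests E \<and> card A = k \<and> (\<forall>e\<in>A. e \<subseteq> S)
    \<and> (\<forall>x\<in>S. \<forall>y\<in>S. (x, y) \<in> (edge_rel A)\<^sup>*)"
  using assms(3)
proof (induction k)
  case 0
  obtain v where "v \<in> V" using G by (auto simp: connected_graph_def)
  then show ?case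
    by (intro exI[of _ "{v}"] exI[of _ "{}"]) (simp add: acyclic_edges_empty)
next
  case (Suc k)
  then obtain S A where S: "S \<subseteq> V" "card S = Suc k" and A: "A \<in> forests E" "card A = k" "\<forall>e\<in>A. e \<subseteq> S"
    and conn: "\<forall>x\<in>S. \<forall>y\<in>S. (x, y) \<in> (edge_rel A)\<^sup>*" by (meson Suc_lessD)
  have "finite S" using S by (simp add: card_ge_0_finite)
  have "finite A" using A(1) simple_graph_finite[OF G(1)] finite_subset[of A E] by simp
  obtain s where s: "s \<in> S" using S by fastforce
  have "S \<noteq> V" using S Suc.prems by auto
  then obtain w where w: "w \<in> V" "w \<notin> S" using S by blast
  have "\<exists>x\<in>S. \<exists>y\<in>V - S. {x, y} \<in> E"
  proof (rule ccontr)
    assume neg: "\<not> ?thesis"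
    have "(s, w) \<in> (edge_rel E)\<^sup>*" using G s w S by (auto simp: connected_graph_edge_rel)
    then have "w \<in> S"
    proof (induction rule: rtrancl_induct)
      case (step y z)
      then have "{y, z} \<in> E" by (simp add: edge_rel_def)
      moreover have "z \<in> V" using calculation G(1) by (auto simp: simple_graph_def)
      ultimately show ?case using neg step by blast
    qed (rule s)
    then show False using w by blast
  qed
  then obtain x y where xy: "x \<in> S" "y \<in> V" "y \<notin> S" "{x, y} \<in> E" by blast
  have yA: "\<forall>e\<in>A. y \<notin> e" using A(3) xy(3) by blast
  have notin: "{x, y} \<notin> A" using yA by blast
  have "(x, y) \<notin> (edge_rel A)\<^sup>*" using isolated_rtrancl[OF _ yA] xy by blast
  then have "acyclic_edges (insert {x, y} A)"
    using acyclic_insert_iff[of A x y] A(1) notin xy by auto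
  moreover have "(u, v) \<in> (edge_rel (insert {x, y} A))\<^sup>*" if "u \<in> insert y S" "v \<in> insert y S" for u v
    using that conn xy(1) unfolding rtrancl_edge_rel_insert by auto
  ultimately show ?case
    using S A xy notin \<open>finite S\<close> \<open>finite A\<close>
    by (intro exI[of _ "insert y S"] exI[of _ "insert {x, y} A"]) auto
qed

text \<open>Contract a tree on all vertices but \<open>u\<close> and \<open>v\<close>. The edges
  from \<open>u\<close> to the tree are parallel, as are those from \<open>v\<close>, so the third
  class consists of the single edge \<open>{u, v}\<close>.\<close>

lemma equal_classes_singleton:
  assumes G: "simple_graph V E" "connected_graph V E" and N: "3 \<le> card V" and m: "0 < m"
    and classes: "\<And>A c i. A \<in> forests E \<Longrightarrow> card A + 2 = card V - 1 \<Longrightarrow>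
      three_class_matroid.class_map E (forests E) A c \<Longrightarrow> i < 3 \<Longrightarrow>
      card {e \<in> three_class_matroid.nonloops E (forests E) A. c e = i} = m"
  shows "m = 1"
proof -
  interpret three_class_matroid E "forests E" "card V - 1"
    using forests_three_class_matroid[OF G N] .
  obtain S A where S: "S \<subseteq> V" "card S = Suc (card V - 3)"
    and A: "A \<in> forests E" "card A = card V - 3" "\<forall>e\<in>A. e \<subseteq> S"
    and conn: "\<forall>x\<in>S. \<forall>y\<in>S. (x, y) \<in> (edge_rel A)\<^sup>*"
    using tree_on_subset[OF G, of "card V - 3"] N by auto
  have "finite V" using G(1) by (simp add: simple_graph_def)
  then have "card (V - S) = 2" using S N by (simp add: card_Diff_subset finite_subset)
  then obtain u v where uv: "V - S = {u, v}" "u \<noteq> v" by (meson card_2_iff)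
  have isolated: "\<forall>e\<in>A. u \<notin> e" "\<forall>e\<in>A. v \<notin> e" using A(3) uv by blast+
  have cA: "card A + 2 = card V - 1" using A(2) N by simp
  obtain c where c: "class_map A c" using ex_class_map[OF A(1) cA] by blast
  have joint: "c e = c f \<longleftrightarrow> \<not> acyclic_edges (insert e (insert f A))"
    if "e \<in> nonloops A" "f \<in> nonloops A" "e \<noteq> f" for e f
    using c that A(1) by (auto simp: class_map_def nonloops_def)
  have shape: "(\<exists>s\<in>S. e = {u, s}) \<or> (\<exists>s\<in>S. e = {v, s})"
    if e: "e \<in> nonloops A" "e \<noteq> {u, v}" for e
  proof -
    have eE: "e \<in> E" "e \<notin> A" "acyclic_edges (insert e A)" using e by (auto simp: nonloops_def)
    obtain a b where ab: "e = {a, b}" "a \<noteq> b" "a \<in> V" "b \<in> V"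
      using edge_endpoints[OF G(1) eE(1)] by metis
    have "(a, b) \<notin> (edge_rel A)\<^sup>*"
      using acyclic_insert_iff[of A a b] eE A(1) ab by simp
    then have "\<not> (a \<in> S \<and> b \<in> S)" using conn by blast
    moreover have "V = S \<union> {u, v}" using uv S by blast
    ultimately show ?thesis using ab e(2) by (auto simp: insert_commute)
  qed
  \<comment> \<open>Two edges from \<open>t\<close> to the tree on \<open>S\<close> close a
    cycle.\<close>
  have star: "c {t, s} = c {t, s'}"
    if "s \<in> S" "s' \<in> S" "t \<notin> S" "{t, s} \<in> nonloops A" "{t, s'} \<in> nonloops A" for t s s'
  proof (cases "s = s'")
    case False
    have "(t, s) \<in> (edge_rel (insert {t, s'} A))\<^sup>*"
      unfolding rtrancl_edge_rel_insert using conn that by blast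
    moreover have "acyclic_edges (insert {t, s'} A)" "{t, s} \<notin> A"
      using that by (auto simp: nonloops_def)
    moreover have "{t, s} \<noteq> {t, s'}" "t \<noteq> s" using False that by (auto simp: doubleton_eq_iff)
    ultimately have "\<not> acyclic_edges (insert {t, s} (insert {t, s'} A))"
      using acyclic_insert_iff[of "insert {t, s'} A" t s] by blast
    then show ?thesis using joint that \<open>{t, s} \<noteq> {t, s'}\<close> by blast
  qed simp
  have uvS: "u \<notin> S" "v \<notin> S" using uv by auto
  have same: "c e = c f"
    if ef: "e \<in> nonloops A" "f \<in> nonloops A" "e \<noteq> {u, v}" "f \<noteq> {u, v}" "u \<in> e \<longleftrightarrow> u \<in> f" for e f
  proof (cases "u \<in> e")
    case True
    then obtain s s' where "s \<in> S" "s' \<in> S" "e = {u, s}" "f = {u, s'}"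
      using shape[OF ef(1,3)] shape[OF ef(2,4)] ef(5) uvS uv(2) by auto
    then show ?thesis using star[of s s' u] ef uvS by simp
  next
    case False
    then obtain s s' where "s \<in> S" "s' \<in> S" "e = {v, s}" "f = {v, s'}"
      using shape[OF ef(1,3)] shape[OF ef(2,4)] ef(5) uvS uv(2) by auto
    then show ?thesis using star[of s s' v] ef uvS by simp
  qed
  have ex: "\<exists>e\<in>nonloops A. c e = i" if "i < 3" for i
  proof -
    have "card {e \<in> nonloops A. c e = i} \<noteq> 0" using classes[OF A(1) cA c that] m by simp
    then have "{e \<in> nonloops A. c e = i} \<noteq> {}" by (metis card.empty)
    then show ?thesis by blast
  qed
  obtain e0 e1 e2 where e: "e0 \<in> nonloops A" "e1 \<in> nonloops A" "e2 \<in> nonloops A"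
    "c e0 = 0" "c e1 = 1" "c e2 = 2"
    using ex[of 0] ex[of 1] ex[of 2] by auto
  \<comment> \<open>Edges other than \<open>{u, v}\<close> fall into at most two classes, but three
    classes are nonempty.\<close>
  have "e0 = {u, v} \<or> e1 = {u, v} \<or> e2 = {u, v}"
    using same[OF e(1,2)] same[OF e(1,3)] same[OF e(2,3)] e(4-6) by fastforce
  then have uv_nl: "{u, v} \<in> nonloops A" using e by auto
  \<comment> \<open>With \<open>{u, v}\<close> added, \<open>S\<close> is still cut off from
    \<open>u\<close> and \<open>v\<close>, so an edge from one of them to \<open>S\<close> closes no
    cycle.\<close>
  have other: "c f \<noteq> c {u, v}" if f: "f \<in> nonloops A" "f \<noteq> {u, v}" for f
  proof -
    have fA: "f \<notin> A" using f by (simp add: nonloops_def)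
    have ac: "acyclic_edges (insert {u, v} A)" using uv_nl by (simp add: nonloops_def)
    have "acyclic_edges (insert {t, s} (insert {u, v} A))"
      if t: "t \<in> {u, v}" "s \<in> S" "f = {t, s}" for t s
    proof -
      have st: "s \<noteq> u" "s \<noteq> v" "t \<noteq> s" using uvS t by auto
      have ni: "(s, u) \<notin> (edge_rel A)\<^sup>*" "(s, v) \<notin> (edge_rel A)\<^sup>*"
        using isolated_rtrancl[of s u A] isolated_rtrancl[of s v A] isolated st by blast+
      then have "(u, s) \<notin> (edge_rel A)\<^sup>*" "(v, s) \<notin> (edge_rel A)\<^sup>*"
        using edge_rel_rtrancl_sym by metis+
      then have "(t, s) \<notin> (edge_rel (insert {u, v} A))\<^sup>*"
        unfolding rtrancl_edge_rel_insert using t(1) by auto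
      then show ?thesis
        using acyclic_insert_iff[OF ac, of t s] f fA t(3) st by simp
    qed
    then have "acyclic_edges (insert f (insert {u, v} A))" using shape[OF f] by auto
    then show ?thesis using joint[OF f(1) uv_nl f(2)] by blast
  qed
  have "{e \<in> nonloops A. c e = c {u, v}} = {{u, v}}" using other uv_nl by blast
  moreover have "c {u, v} < 3" using c uv_nl by (simp add: class_map_def)
  ultimately show "m = 1" using classes[OF A(1) cA c, of "c {u, v}"] by simp
qed

section \<open>Cycle graphs\<close>

lemma cycle_edge_Union:
  assumes "cycle_list vs"
  shows "\<Union> (cycle_edges vs) = set vs"
proof -
  have "0 < length vs" using assms by (auto simp: cycle_list_def)
  then have "Suc i mod length vs < length vs" for i by simp
  then show ?thesis by (auto simp: cycle_edges_def set_conv_nth)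
qed

text \<open>An edge off a cycle in \<open>E\<close> could be deleted without destroying that cycle,
  so the cycle is all of \<open>E\<close>; counting shows that it visits every vertex.\<close>

lemma cycle_graph_if_one_circuit:
  assumes G: "simple_graph V E" and card: "card E = card V"
    and circuit: "\<And>e. e \<in> E \<Longrightarrow> acyclic_edges (E - {e})" and dep: "\<not> acyclic_edges E"
  shows "is_cycle_graph V E"
proof -
  obtain vs where vs: "cycle_list vs" "cycle_edges vs \<subseteq> E"
    using dep by (auto simp: acyclic_edges_def)
  have E: "E = cycle_edges vs"
  proof (rule ccontr)
    assume "E \<noteq> cycle_edges vs"
    then obtain e where e: "e \<in> E" "e \<notin> cycle_edges vs" using vs by blast
    then have "cycle_edges vs \<subseteq> E - {e}" using vs by blast
    then show False using circuit[OF e(1)] vs(1) by (auto simp: acyclic_edges_def)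
  qed
  have "finite V" "\<Union> E \<subseteq> V" using G by (auto simp: simple_graph_def)
  moreover have "card (set vs) = card V"
    using card card_cycle_edges[OF vs(1)] E vs(1) by (simp add: cycle_list_def distinct_card)
  ultimately have "set vs = V"
    using cycle_edge_Union[OF vs(1)] E card_subset_eq[of V "set vs"] by simp
  then show ?thesis using vs(1) E by (auto simp: is_cycle_graph_def)
qed

text \<open>The remaining edges still connect all vertices, so they contain a spanning tree, and by
  counting they are that tree.\<close>

lemma cycle_minus_edge_acyclic:
  assumes G: "simple_graph (set vs) (cycle_edges vs)" "connected_graph (set vs) (cycle_edges vs)"
    and vs: "cycle_list vs" and e: "e \<in> cycle_edges vs"
  shows "acyclic_edges (cycle_edges vs - {e})"
proof -
  let ?E = "cycle_edges vs - {e}"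
  obtain i where i: "i < length vs" "e = {vs ! i, vs ! (Suc i mod length vs)}"
    using e by (auto simp: cycle_edges_def)
  have "(vs ! (Suc i mod length vs), vs ! i) \<in> (edge_rel ?E)\<^sup>*"
    using cycle_minus_edge_joined[OF vs i(1)] i(2) by simp
  note joined = this edge_rel_rtrancl_sym[OF this]
  have "edge_rel (cycle_edges vs) \<subseteq> (edge_rel ?E)\<^sup>*"
  proof safe
    fix x y assume "(x, y) \<in> edge_rel (cycle_edges vs)"
    then have xy: "{x, y} \<in> cycle_edges vs" by (simp add: edge_rel_def)
    show "(x, y) \<in> (edge_rel ?E)\<^sup>*"
    proof (cases "{x, y} = e")
      case True
      then show ?thesis using joined unfolding i(2) by (auto simp: doubleton_eq_iff)
    next
      case False
      then show ?thesis using xy by (auto simp: edge_rel_def)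
    qed
  qed
  then have "(edge_rel (cycle_edges vs))\<^sup>* \<subseteq> (edge_rel ?E)\<^sup>*" by (rule rtrancl_subset_rtrancl)
  then have "connected_graph (set vs) ?E" using G(2) by (auto simp: connected_graph_edge_rel)
  then obtain B where B: "B \<in> forests ?E" "card B + 1 = card (set vs)"
    using spanning_tree_exists[of "set vs" ?E] simple_graph_subset[OF G(1)] by blast
  have fin: "finite (cycle_edges vs)" using simple_graph_finite[OF G(1)] .
  have "card ?E + 1 = card (set vs)"
    using e fin card_cycle_edges[OF vs] vs
    by (auto simp: cycle_list_def distinct_card)
  then have "B = ?E" using B fin by (intro card_subset_eq) auto
  then show ?thesis using B(1) by simp
qed

text \<open>Every proper subset of the edges of a cycle is a forest.\<close>

lemma num_forests_cycle:
  assumes "simple_graph V E" "connected_graph V E" "is_cycle_graph V E" "k < card V"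
  shows "num_forests E k = card V choose k"
proof -
  obtain vs where vs: "cycle_list vs" "V = set vs" "E = cycle_edges vs"
    using assms(3) by (auto simp: is_cycle_graph_def)
  have card: "card E = card V"
    using card_cycle_edges[OF vs(1)] vs by (simp add: cycle_list_def distinct_card)
  have "acyclic_edges F" if F: "F \<subseteq> E" "card F = k" for F
  proof -
    have "F \<noteq> E" using F card assms(4) by auto
    then obtain e where "e \<in> E" "F \<subseteq> E - {e}" using F(1) by blast
    then show ?thesis
      using cycle_minus_edge_acyclic assms(1,2) vs acyclic_mono by metis
  qed
  then have "spanning_forests E k = {F. F \<subseteq> E \<and> card F = k}"
    by (auto simp: spanning_forests_def)
  then show ?thesis
    using n_subsets[OF simple_graph_finite[OF assms(1)], of k] card by (simp add: num_forests_def)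
qed

section \<open>The ratio inequality for graphs and its equality case\<close>

theorem proposition1p11:
  fixes V :: "'a set" and E :: "'a set set" and N :: nat
  assumes "simple_graph V E"
    and "connected_graph V E"
    and "card V = N"
    and "N \<ge> 3"
  shows "(real (num_forests E (N - 2)))\<^sup>2
           / (real (num_forests E (N - 3)) * real (num_forests E (N - 1)))
           \<ge> 3 / 2 * (1 + 1 / (real N - 2))
    \<and> ((real (num_forests E (N - 2)))\<^sup>2
           / (real (num_forests E (N - 3)) * real (num_forests E (N - 1)))
           = 3 / 2 * (1 + 1 / (real N - 2))
        \<longleftrightarrow> is_cycle_graph V E)"
proof -
  note G = assms(1,2)
  have N: "3 \<le> card V" "card V = N" using assms by auto
  interpret three_class_matroid E "forests E" "card V - 1"
    using forests_three_class_matroid[OF G N(1)] .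
  have count: "count k = real (num_forests E k)" for k
    by (simp add: count_def num_forests_def spanning_forests_def conj_ac)
  define a b t where "a = real (num_forests E (N - 3))" and "b = real (num_forests E (N - 2))"
    and "t = real (num_forests E (N - 1))"
  have r: "card V - 1 = N - 1" "N - 1 - 2 = N - 3" "N - 1 - 1 = N - 2"
    "real (N - 1) = real N - 1"
    using N by auto
  note top = top_log_concavity[unfolded r count, folded a_def b_def t_def]
  obtain T where T: "T \<in> forests E" "card T = N - 1" using base_exists r by auto
  \<comment> \<open>Positivity of the denominator is essential, as a quotient by zero would be
    zero.\<close>
  have pos: "0 < real (num_forests E k)" if "k \<le> N - 1" for k
  proof -
    have "above {} k \<noteq> {}" using that r indep_mono[OF T(1)] by (intro extend_indep) auto
    then have "spanning_forests E k \<noteq> {}" by (auto simp: above_def spanning_forests_def)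
    moreover have "finite (spanning_forests E k)"
      using finite_E by (simp add: spanning_forests_def)
    ultimately show ?thesis by (simp add: num_forests_def card_gt_0_iff)
  qed
  have "0 < a" "0 < t" using pos by (simp_all add: a_def t_def)
  have N': "0 < real N - 2" using N by linarith
  \<comment> \<open>With \<open>r = N - 1\<close> this is \<open>3 * r / (2 * (r - 1))\<close>, the
    constant in \<open>top_log_concavity\<close>.\<close>
  have q: "3 / 2 * (1 + 1 / (real N - 2)) = 3 * (real N - 1) / (2 * (real N - 2))"
    using N' by (simp add: field_simps)
  have le: "3 / 2 * (1 + 1 / (real N - 2)) \<le> b\<^sup>2 / (a * t)"
  proof -
    have "3 * (real N - 1) * (a * t) \<le> b\<^sup>2 * (2 * (real N - 2))" using top(1) by (simp add: algebra_simps)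
    then show ?thesis unfolding q using N' \<open>0 < a\<close> \<open>0 < t\<close>
      by (simp add: pos_divide_le_eq pos_le_divide_eq mult_ac)
  qed
  have eq: "b\<^sup>2 / (a * t) = 3 / 2 * (1 + 1 / (real N - 2)) \<longleftrightarrow>
      3 * (real N - 1) * a * t = 2 * (real N - 1 - 1) * b\<^sup>2"
  proof -
    have "a * t \<noteq> 0" "2 * (real N - 2) \<noteq> 0" using \<open>0 < a\<close> \<open>0 < t\<close> N' by auto
    then show ?thesis unfolding q by (subst frac_eq_eq) (auto simp: algebra_simps)
  qed
  have "is_cycle_graph V E" if e: "3 * (real N - 1) * a * t = 2 * (real N - 1 - 1) * b\<^sup>2"
  proof -
    obtain m where m: "0 < m" "\<And>A c i. A \<in> forests E \<Longrightarrow> card A + 2 = card V - 1 \<Longrightarrow>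
        class_map A c \<Longrightarrow> i < 3 \<Longrightarrow> card {e \<in> nonloops A. c e = i} = m"
      using top(2)[OF e] unfolding r by blast
    have "m = 1" by (rule equal_classes_singleton[OF G N(1) m])
    have single: "{e} \<in> forests E" if eE: "e \<in> E" for e
    proof -
      obtain u v where uv: "e = {u, v}" "u \<noteq> v" using edge_endpoints[OF G(1) eE] by metis
      show ?thesis
        using acyclic_edges_empty acyclic_insert_iff[of "{}" u v] isolated_rtrancl[of u v "{}"] uv eE by auto
    qed
    have "card E = Suc (card V - 1)" "\<And>e. e \<in> E \<Longrightarrow> E - {e} \<in> forests E"
      using one_circuit[OF m(2)[unfolded \<open>m = 1\<close>] single] by blast+
    \<comment> \<open>\<open>E\<close> has one element more than the rank.\<close>
    moreover from this have "\<not> acyclic_edges E" using indep_card_le[of E] by auto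
    ultimately show ?thesis using N by (intro cycle_graph_if_one_circuit[OF G(1)]) auto
  qed
  moreover have "3 * (real N - 1) * a * t = 2 * (real N - 1 - 1) * b\<^sup>2" if "is_cycle_graph V E"
  proof -
    have num: "num_forests E k = N choose k" if "k < N" for k
      using num_forests_cycle[OF G \<open>is_cycle_graph V E\<close>] that N by simp
    \<comment> \<open>Reflecting the lower indices turns the binomial coefficients into polynomials
      in \<open>N\<close> of degree at most three.\<close>
    have sym: "N choose (N - 1) = N choose 1" "N choose (N - 2) = N choose 2"
      "N choose (N - 3) = N choose 3"
      using assms(4) by (simp_all add: binomial_symmetric[symmetric])
    have t: "t = real N" using num[of "N - 1"] sym(1) assms(4) by (simp add: t_def)
    have b: "b = real N * (real N - 1) / 2"
    proof -
      have "b = real N gchoose 2"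
        using num[of "N - 2"] sym(2) assms(4) by (simp add: b_def binomial_gbinomial)
      then show ?thesis by (simp add: gbinomial_prod_rev numeral_2_eq_2)
    qed
    have a: "a = real N * (real N - 1) * (real N - 2) / 6"
    proof -
      have "a = real N gchoose 3"
        using num[of "N - 3"] sym(3) assms(4) by (simp add: a_def binomial_gbinomial)
      then show ?thesis by (simp add: gbinomial_prod_rev numeral_3_eq_3 fact_numeral)
    qed
    show ?thesis unfolding t a b by (simp add: power2_eq_square field_simps)
  qed
  ultimately show ?thesis
    using le eq unfolding a_def b_def t_def by blast
qed

end
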